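(* Let $k$ be an algebraically closed field of characteristic $0$, $G=\mathbf{SL}_2$, and $V=R_{d_1}\oplus\dots\oplus R_{d_m}$ with $d_1,\dots,d_m\in\mathbb Z_+$. Then $\mathrm{pol\,ind}(V)=1$ if $d_i=1$ for some $i$, and $\mathrm{pol\,ind}(V)=\infty$ otherwise.
   Context: $R_d$ is the $\mathbf{SL}_2$-module of binary forms of degree $d$ in $x,y$. For $n\in\mathbb N$, $G$ acts diagonally on $V^{\oplus n}$. Polarizations of $f\in k[V]$: $f(\alpha_1v_1+\dots+\alpha_nv_n)=\sum_{(i_1,\dots,i_n)\in\mathbb Z_+^n}\alpha_1^{i_1}\cdots\alpha_n^{i_n}f_{i_1,\dots,i_n}(v_1,\dots,v_n)$; $\mathrm{pol}_nk[V]^G\subseteq k[V^{\oplus n}]^G$ is generated by polarizations of all $f\in k[V]^G$. $\mathcal N_{V^{\oplus n},G}=\{w:F(w)=F(0)\ \forall F\in k[V^{\oplus n}]^G\}$, $\mathcal P_{V^{\oplus n},G}=\{w:h(w)=h(0)\ \forall h\in\mathrm{pol}_nk[V]^G\}$. The polarization index $\mathrm{pol\,ind}(V)$ is the supremum of all $n\in\mathbb N$ with $\mathcal N_{V^{\oplus n},G}=\mathcal P_{V^{\oplus n},G}$. *)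

theory Defs
  imports "HOL-Computational_Algebra.Polynomial" "HOL-Library.Extended_Nat"
begin

definition linear_on :: "('a \<Rightarrow> 'k::comm_ring_1) set \<Rightarrow> (('a \<Rightarrow> 'k) \<Rightarrow> 'k) \<Rightarrow> bool" where
  "linear_on S L \<longleftrightarrow>
     (\<forall>u\<in>S. \<forall>v\<in>S. L (\<lambda>z. u z + v z) = L u + L v) \<and>
     (\<forall>a. \<forall>u\<in>S. L (\<lambda>z. a * u z) = a * L u)"

inductive_set gen_alg :: "('b \<Rightarrow> 'k::comm_ring_1) set \<Rightarrow> ('b \<Rightarrow> 'k) set" for A where
  const: "(\<lambda>_. c) \<in> gen_alg A"
| gen: "f \<in> A \<Longrightarrow> f \<in> gen_alg A"
| add: "f \<in> gen_alg A \<Longrightarrow> g \<in> gen_alg A \<Longrightarrow> (\<lambda>u. f u + g u) \<in> gen_alg A"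
| mult: "f \<in> gen_alg A \<Longrightarrow> g \<in> gen_alg A \<Longrightarrow> (\<lambda>u. f u * g u) \<in> gen_alg A"

definition poly_funs :: "('a \<Rightarrow> 'k::comm_ring_1) set \<Rightarrow> (('a \<Rightarrow> 'k) \<Rightarrow> 'k) set" where
  "poly_funs S = gen_alg {L. linear_on S L}"

text \<open>g = (a,b,c,e) stands for the matrix [[a,b],[c,e]].\<close>
definition SL2 :: "('k::comm_ring_1 \<times> 'k \<times> 'k \<times> 'k) set" where
  "SL2 = {(a, b, c, e). a * e - b * c = 1}"

text \<open>Action on (families of) binary forms: (g.f)(x,y) = f(g^{-1}(x,y)),
  applied to every component form.\<close>
definition sl2_act :: "('k::comm_ring_1 \<times> 'k \<times> 'k \<times> 'k) \<Rightarrow> ('i \<times> 'k \<times> 'k \<Rightarrow> 'k) \<Rightarrow> ('i \<times> 'k \<times> 'k \<Rightarrow> 'k)" where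
  "sl2_act g w = (case g of (a, b, c, e) \<Rightarrow>
      (\<lambda>(i, x, y). w (i, e * x - b * y, - c * x + a * y)))"

definition binary_forms :: "nat \<Rightarrow> ('k::comm_ring_1 \<Rightarrow> 'k \<Rightarrow> 'k) set" where
  "binary_forms d = {f. \<exists>c. \<forall>x y. f x y = (\<Sum>j\<le>d. c j * x ^ (d - j) * y ^ j)}"

text \<open>V = R_{d_1} + ... + R_{d_m}, ds = [d_1,...,d_m]; component i is v(i,-,-).\<close>
definition Vspace :: "nat list \<Rightarrow> (nat \<times> 'k \<times> 'k \<Rightarrow> 'k::comm_ring_1) set" where
  "Vspace ds = {v. (\<forall>i<length ds. (\<lambda>x y. v (i, x, y)) \<in> binary_forms (ds ! i)) \<and>
                   (\<forall>i x y. length ds \<le> i \<longrightarrow> v (i, x, y) = 0)}"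

text \<open>V^{+n}: component t (t < n) is the vector w((t,-),-,-) of V.\<close>
definition Vsum :: "nat \<Rightarrow> nat list \<Rightarrow> ((nat \<times> nat) \<times> 'k \<times> 'k \<Rightarrow> 'k::comm_ring_1) set" where
  "Vsum n ds = {w. (\<forall>t<n. (\<lambda>(i, x, y). w ((t, i), x, y)) \<in> Vspace ds) \<and>
                   (\<forall>t i x y. n \<le> t \<longrightarrow> w ((t, i), x, y) = 0)}"

definition invariants :: "('i \<times> 'k \<times> 'k \<Rightarrow> 'k::comm_ring_1) set \<Rightarrow> ((('i \<times> 'k \<times> 'k) \<Rightarrow> 'k) \<Rightarrow> 'k) set" where
  "invariants S = {F \<in> poly_funs S. \<forall>g\<in>SL2. \<forall>w\<in>S. F (sl2_act g w) = F w}"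

definition lin_comb :: "nat \<Rightarrow> (nat \<Rightarrow> 'k) \<Rightarrow> ((nat \<times> nat) \<times> 'k \<times> 'k \<Rightarrow> 'k::comm_ring_1) \<Rightarrow> (nat \<times> 'k \<times> 'k \<Rightarrow> 'k)" where
  "lin_comb n \<alpha> w = (\<lambda>(i, x, y). \<Sum>t<n. \<alpha> t * w ((t, i), x, y))"

text \<open>The coefficients f_I(w) of f(alpha_1 v_1 + ... + alpha_n v_n) as a polynomial
  in alpha_1..alpha_n; multi-indices I : nat => nat supported on {0..<n}.\<close>
definition pol_coeffs :: "nat \<Rightarrow> ((nat \<times> 'k \<times> 'k \<Rightarrow> 'k::comm_ring_1) \<Rightarrow> 'k) \<Rightarrow> ((nat \<times> nat) \<times> 'k \<times> 'k \<Rightarrow> 'k) \<Rightarrow> (nat \<Rightarrow> nat) \<Rightarrow> 'k" where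
  "pol_coeffs n f w = (THE c. finite {I. c I \<noteq> 0} \<and>
       (\<forall>I. c I \<noteq> 0 \<longrightarrow> (\<forall>t. n \<le> t \<longrightarrow> I t = 0)) \<and>
       (\<forall>\<alpha>. f (lin_comb n \<alpha> w) = (\<Sum>I\<in>{I. c I \<noteq> 0}. c I * (\<Prod>t<n. \<alpha> t ^ I t))))"

definition pol_alg :: "nat \<Rightarrow> nat list \<Rightarrow> ((((nat \<times> nat) \<times> 'k \<times> 'k) \<Rightarrow> 'k::comm_ring_1) \<Rightarrow> 'k) set" where
  "pol_alg n ds = gen_alg {(\<lambda>w. pol_coeffs n f w I) | f I. f \<in> invariants (Vspace ds)}"

definition nullcone :: "nat \<Rightarrow> nat list \<Rightarrow> ((nat \<times> nat) \<times> 'k \<times> 'k \<Rightarrow> 'k::comm_ring_1) set" where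
  "nullcone n ds = {w \<in> Vsum n ds. \<forall>F\<in>invariants (Vsum n ds). F w = F (\<lambda>_. 0)}"

definition pol_nullcone :: "nat \<Rightarrow> nat list \<Rightarrow> ((nat \<times> nat) \<times> 'k \<times> 'k \<Rightarrow> 'k::comm_ring_1) set" where
  "pol_nullcone n ds = {w \<in> Vsum n ds. \<forall>h\<in>pol_alg n ds. h w = h (\<lambda>_. 0)}"

definition pol_ind :: "'k::comm_ring_1 itself \<Rightarrow> nat list \<Rightarrow> enat" where
  "pol_ind _ ds = Sup (enat ` {n. 1 \<le> n \<and>
      (nullcone n ds :: ((nat \<times> nat) \<times> 'k \<times> 'k \<Rightarrow> 'k) set) = pol_nullcone n ds})"

end

(*
A family w of binary forms is annihilated by all invariants without constant term iff its members
f_i have a common root u of multiplicity > d_i / 2. If there is such a root, a one-parameter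
subgroup contracts w to 0. If there is none, then some h = f_i^a f_j^b with balanced exponents is a
nonzero form of even degree 2m all of whose roots have multiplicity at most m; its roots can be
paired so that partners differ, and the sums over all permutations of the N-th powers of the product
of the brackets of the pairs are invariants of h that cannot all vanish.

Hence w lies in the polarization nullcone iff every linear combination of v_1, ..., v_n has such a
root, and in the nullcone iff one root serves for all of them. When no d_i equals 1 the roots are
multiple, so they cannot move in a pencil v + a v' by a Bertini argument (the Wronskian would vanish),
and they are the same for all vectors by uniqueness. When d_i = 1, the vectors x and y have no common
root although each of their linear combinations has one.
*)
theory Submission
  imports Defs "HOL-Combinatorics.Permutations" "HOL-Library.FuncSet"
begin

section \<open>Binary forms as products of brackets\<close>

text \<open>The obstacle is that brackets of roots are not visibly polynomial in a form: its linear
  factors are determined only up to order and scaling, whereas \<open>invariants\<close> asks for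
  polynomials in linear functionals. Summing over all permutations removes the order. The sum is a
  permanent, and Ryser's formula rewrites it through products, over the roots of h, of values of
  auxiliary forms; these products are in turn values of h. A single symmetrized bracket product may
  vanish, since swapping the partners of a pair flips its sign, but in characteristic 0 the power
  sums of a finite family vanish together only if every member does. Products of two members suffice
  because a nonzero form has at most one root of multiplicity above half its degree, so one fixed
  member dictates the candidate. If the roots of f_i and f_j differ and exceed half the degree by
  A/2 and B/2, then f_i^(2B) f_j^(2A) is balanced: the surplus of one factor at its root is at most
  what the other factor lacks there. The factor 2 makes the degree even, so that roots can be
  paired.\<close>

definition br :: "'k::comm_ring_1 \<times> 'k \<Rightarrow> 'k \<times> 'k \<Rightarrow> 'k" where
  "br u v = fst u * snd v - snd u * fst v"

text \<open>An entry l stands for the linear form vanishing along l. Scalars are absorbed into the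
  entries, an entry (0, 0) makes the product zero, and substituting the inverse of a matrix of
  determinant 1 amounts to applying that matrix to every entry.\<close>

definition br_prod :: "('k::comm_ring_1 \<times> 'k) list \<Rightarrow> 'k \<Rightarrow> 'k \<Rightarrow> 'k" where
  "br_prod ls x y = (\<Prod>l\<leftarrow>ls. br l (x, y))"

lemma binary_forms_zero: "(\<lambda>x y. 0) \<in> binary_forms d"
  by (auto simp: binary_forms_def intro!: exI[of _ "\<lambda>_. 0"])

lemma binary_forms_add:
  assumes "f \<in> binary_forms d" "g \<in> binary_forms d"
  shows "(\<lambda>x y. f x y + g x y) \<in> binary_forms d"
proof -
  obtain c c' where "\<And>x y. f x y = (\<Sum>j\<le>d. c j * x ^ (d - j) * y ^ j)"
    "\<And>x y. g x y = (\<Sum>j\<le>d. c' j * x ^ (d - j) * y ^ j)"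
    using assms by (auto simp: binary_forms_def)
  then show ?thesis
    by (auto simp: binary_forms_def sum.distrib[symmetric] algebra_simps intro!: exI[of _ "\<lambda>j. c j + c' j"])
qed

lemma binary_forms_scale:
  assumes "f \<in> binary_forms d"
  shows "(\<lambda>x y. a * f x y) \<in> binary_forms d"
proof -
  obtain c where "\<And>x y. f x y = (\<Sum>j\<le>d. c j * x ^ (d - j) * y ^ j)"
    using assms by (auto simp: binary_forms_def)
  then show ?thesis
    by (auto simp: binary_forms_def sum_distrib_left algebra_simps intro!: exI[of _ "\<lambda>j. a * c j"])
qed

lemma binary_forms_sum:
  assumes "\<And>i. i \<in> A \<Longrightarrow> f i \<in> binary_forms d"
  shows "(\<lambda>x y. \<Sum>i\<in>A. f i x y) \<in> binary_forms d"
  using assms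
  by (induction A rule: infinite_finite_induct) (auto intro: binary_forms_zero binary_forms_add)

lemma binary_forms_const: "(\<lambda>x y. a) \<in> binary_forms 0"
  by (auto simp: binary_forms_def)

lemma binary_forms_monom: "i \<le> d \<Longrightarrow> (\<lambda>x y. c * x ^ (d - i) * y ^ i) \<in> binary_forms d"
  by (auto simp: binary_forms_def if_distrib if_distribR sum.delta cong: if_cong
      intro!: exI[of _ "\<lambda>j. if j = i then c else 0"])

lemma binary_forms_mult:
  assumes "f \<in> binary_forms d" "g \<in> binary_forms e"
  shows "(\<lambda>x y. f x y * g x y) \<in> binary_forms (d + e)"
proof -
  obtain c c' where c: "\<And>x y. f x y = (\<Sum>j\<le>d. c j * x ^ (d - j) * y ^ j)"
    "\<And>x y. g x y = (\<Sum>j\<le>e. c' j * x ^ (e - j) * y ^ j)"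
    using assms by (auto simp: binary_forms_def)
  have "f x y * g x y = (\<Sum>i\<le>d. \<Sum>j\<le>e. (c i * c' j) * x ^ (d + e - (i + j)) * y ^ (i + j))" for x y
    unfolding c sum_product
  proof (intro sum.cong refl)
    fix i j assume "i \<in> {..d}" "j \<in> {..e}"
    then have "d + e - (i + j) = (d - i) + (e - j)" by auto
    then show "c i * x ^ (d - i) * y ^ i * (c' j * x ^ (e - j) * y ^ j)
       = c i * c' j * x ^ (d + e - (i + j)) * y ^ (i + j)"
      by (simp only: power_add ac_simps)
  qed
  then show ?thesis
    by (simp only:) (intro binary_forms_sum binary_forms_monom, auto)
qed

lemma binary_forms_power:
  "f \<in> binary_forms d \<Longrightarrow> (\<lambda>x y. f x y ^ n) \<in> binary_forms (n * d)"
proof (induction n)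
  case 0 then show ?case by (simp add: binary_forms_const)
next
  case (Suc n)
  then show ?case using binary_forms_mult[of f d "\<lambda>x y. f x y ^ n" "n * d"] by simp
qed

lemma binary_forms_linear: "(\<lambda>x y. a * x + b * y) \<in> binary_forms 1"
  by (auto simp: binary_forms_def intro!: exI[of _ "\<lambda>j. if j = 0 then a else b"])

lemma binary_forms_br: "(\<lambda>x y. br u (x, y)) \<in> binary_forms 1"
  using binary_forms_linear[of "- snd u" "fst u"] by (simp add: br_def algebra_simps)

lemma binary_forms_br_prod: "br_prod ls \<in> binary_forms (length ls)"
proof (induction ls)
  case Nil
  then show ?case using binary_forms_const[of 1] by (simp add: br_prod_def[abs_def])
next
  case (Cons l ls)
  then show ?case
    using binary_forms_mult[OF binary_forms_br Cons.IH, of l] by (simp add: br_prod_def[abs_def])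
qed

lemma binary_forms_subst:
  assumes "f \<in> binary_forms d"
  shows "(\<lambda>x y. f (a * x + b * y) (c * x + e * y)) \<in> binary_forms d"
proof -
  obtain k where k: "\<And>x y. f x y = (\<Sum>j\<le>d. k j * x ^ (d - j) * y ^ j)"
    using assms by (auto simp: binary_forms_def)
  have "(\<lambda>x y. k j * (a * x + b * y) ^ (d - j) * (c * x + e * y) ^ j) \<in> binary_forms d"
    if "j \<le> d" for j
  proof -
    have "(\<lambda>x y. (a * x + b * y) ^ (d - j) * (c * x + e * y) ^ j) \<in> binary_forms d"
      using binary_forms_mult[OF binary_forms_power[OF binary_forms_linear[of a b], of "d - j"]
         binary_forms_power[OF binary_forms_linear[of c e], of j]] that by simp
    from binary_forms_scale[OF this, of "k j"] show ?thesis by (simp add: mult.assoc)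
  qed
  then show ?thesis unfolding k by (intro binary_forms_sum) auto
qed

lemma binary_forms_homogeneous:
  assumes "f \<in> binary_forms d"
  shows "f (s * x) (s * y) = s ^ d * f x y"
proof -
  obtain c where c: "\<And>x y. f x y = (\<Sum>j\<le>d. c j * x ^ (d - j) * y ^ j)"
    using assms by (auto simp: binary_forms_def)
  have "s ^ d = s ^ (d - j) * s ^ j" if "j \<le> d" for j
    using that by (simp flip: power_add)
  then show ?thesis
    unfolding c sum_distrib_left by (intro sum.cong) (auto simp: power_mult_distrib algebra_simps)
qed

text \<open>Restriction to the line (a, c) + z (b, e); it reduces questions on forms to degrees,
  roots and derivatives of univariate polynomials.\<close>

lemma binary_forms_poly:
  assumes "f \<in> binary_forms d"
  obtains p where "degree p \<le> d" "\<And>z. f (a + b * z) (c + e * z) = poly p z"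
proof -
  obtain k where k: "\<And>x y. f x y = (\<Sum>j\<le>d. k j * x ^ (d - j) * y ^ j)"
    using assms by (auto simp: binary_forms_def)
  define p where "p = (\<Sum>j\<le>d. smult (k j) ([:a, b:] ^ (d - j) * [:c, e:] ^ j))"
  have "degree ([:a, b:] ^ (d - j) * [:c, e:] ^ j) \<le> d" if "j \<le> d" for j
  proof -
    have "degree ([:a, b:] ^ (d - j) * [:c, e:] ^ j) \<le> degree [:a,b:] * (d - j) + degree [:c,e:] * j"
      by (rule order_trans[OF degree_mult_le]) (intro add_mono degree_power_le)
    also have "\<dots> \<le> 1 * (d - j) + 1 * j" by (intro add_mono mult_right_mono) auto
    finally show ?thesis using that by simp
  qed
  then have "degree p \<le> d"
    unfolding p_def by (intro degree_sum_le) (auto intro: order_trans[OF degree_smult_le])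
  moreover have "f (a + b * z) (c + e * z) = poly p z" for z
    unfolding k p_def by (simp add: poly_sum algebra_simps)
  ultimately show ?thesis using that by blast
qed

context
  assumes alg_closed: "\<forall>p :: 'k::field_char_0 poly. 0 < degree p \<longrightarrow> (\<exists>x. poly p x = 0)"
begin

text \<open>Roots are split off one at a time in the chart x = 1: a root r of f(1, z) yields the
  factor y - r x. If the top coefficient vanishes, the root lies at infinity and x divides
  f.\<close>

lemma binary_forms_factor:
  fixes f :: "'k \<Rightarrow> 'k \<Rightarrow> 'k"
  assumes "f \<in> binary_forms d"
  obtains a ls where "length ls = d" "\<And>x y. f x y = a * br_prod ls x y"
proof -
  have "\<exists>a ls. length ls = d \<and> (\<forall>x y. (\<Sum>j\<le>d. c j * x ^ (d - j) * y ^ j) = a * br_prod ls x y)"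
    for c :: "nat \<Rightarrow> 'k"
  proof (induction d arbitrary: c)
    case 0
    show ?case by (auto simp: br_prod_def)
  next
    case (Suc d)
    have key: "\<exists>a ls. length ls = Suc d \<and>
        (\<forall>x y. (\<Sum>j\<le>Suc d. c j * x ^ (Suc d - j) * y ^ j) = a * br_prod ls x y)"
      if "\<And>x y. (\<Sum>j\<le>Suc d. c j * x ^ (Suc d - j) * y ^ j) =
          br u (x, y) * (\<Sum>j\<le>d. c' j * x ^ (d - j) * y ^ j)" for u c'
    proof -
      obtain a ls where "length ls = d"
        "\<And>x y. (\<Sum>j\<le>d. c' j * x ^ (d - j) * y ^ j) = a * br_prod ls x y"
        using Suc.IH by metis
      then show ?thesis unfolding that by (intro exI[of _ a] exI[of _ "u # ls"]) (simp add: br_prod_def)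
    qed
    show ?case
    proof (cases "c (Suc d) = 0")
      case True
      have "(\<Sum>j\<le>Suc d. c j * x ^ (Suc d - j) * y ^ j) = (\<Sum>j\<le>d. x * (c j * x ^ (d - j) * y ^ j))" for x y
        using True by (auto intro!: sum.cong simp: Suc_diff_le)
      \<comment> \<open>The bracket with (0, -1) is x.\<close>
      then show ?thesis
        by (intro key[of "(0, -1)" c]) (simp add: br_def sum_distrib_left)
    next
      case False
      define p where "p = (\<Sum>j\<le>Suc d. monom (c j) j)"
      have cp: "coeff p j = (if j \<le> Suc d then c j else 0)" for j
        unfolding p_def by (simp add: coeff_sum sum.delta del: sum.atMost_Suc)
      have dp: "degree p = Suc d"
        using False by (intro antisym degree_le le_degree) (auto simp: cp)
      obtain r where "poly p r = 0" using alg_closed dp by force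
      then obtain q where q: "p = [:-r, 1:] * q" by (auto simp: poly_eq_0_iff_dvd)
      have dq: "degree q = d"
        using dp degree_mult_eq[of "[:-r,1:]" q] unfolding q by (cases "q = 0") auto
      have c: "c j = (if j = 0 then 0 else coeff q (j - 1)) - r * coeff q j" if "j \<le> Suc d" for j
        using cp[of j] that unfolding q by (cases j) (auto simp: coeff_pCons)
      have "(\<Sum>j\<le>Suc d. c j * x ^ (Suc d - j) * y ^ j) =
          br (1, r) (x, y) * (\<Sum>j\<le>d. coeff q j * x ^ (d - j) * y ^ j)" for x y
      proof -
        have "(\<Sum>j\<le>Suc d. c j * x ^ (Suc d - j) * y ^ j) =
           (\<Sum>j\<le>Suc d. (if j = 0 then 0 else coeff q (j - 1)) * x ^ (Suc d - j) * y ^ j)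
           - (\<Sum>j\<le>Suc d. r * coeff q j * x ^ (Suc d - j) * y ^ j)"
          unfolding sum_subtractf[symmetric] by (intro sum.cong) (auto simp: c algebra_simps)
        also have "(\<Sum>j\<le>Suc d. (if j = 0 then 0 else coeff q (j - 1)) * x ^ (Suc d - j) * y ^ j)
            = y * (\<Sum>j\<le>d. coeff q j * x ^ (d - j) * y ^ j)"
          by (subst sum.atMost_Suc_shift) (simp add: sum_distrib_left algebra_simps)
        also have "(\<Sum>j\<le>Suc d. r * coeff q j * x ^ (Suc d - j) * y ^ j)
            = r * x * (\<Sum>j\<le>d. coeff q j * x ^ (d - j) * y ^ j)"
          using dq by (auto simp: coeff_eq_0 sum_distrib_left Suc_diff_le algebra_simps intro!: sum.cong)
        finally show ?thesis by (simp add: br_def algebra_simps)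
      qed
      then show ?thesis by (rule key)
    qed
  qed
  then show ?thesis using assms that unfolding binary_forms_def by force
qed

text \<open>In positive degree the leading scalar can be moved into the first factor. In this way
  the zero form, too, becomes a product of brackets.\<close>

lemma binary_forms_split:
  fixes f :: "'k \<Rightarrow> 'k \<Rightarrow> 'k"
  assumes "f \<in> binary_forms d" "0 < d"
  shows "\<exists>ls. length ls = d \<and> f = br_prod ls"
proof -
  obtain a ls where ls: "length ls = d" "\<And>x y. f x y = a * br_prod ls x y"
    using binary_forms_factor[OF assms(1)] by blast
  then obtain l ls' where l: "ls = l # ls'" using assms(2) by (cases ls) auto
  have "f = br_prod ((a * fst l, a * snd l) # ls')"
    by (intro ext) (simp add: ls(2) l br_prod_def br_def algebra_simps)
  then show ?thesis using ls(1) l by (metis length_Cons)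
qed

end

section \<open>Families of forms and contraction by a torus\<close>

text \<open>\<open>Vspace\<close> and \<open>Vsum\<close> are both of this kind, so one nullcone
  criterion serves V and its multiples.\<close>

definition form_families :: "'i set \<Rightarrow> ('i \<Rightarrow> nat) \<Rightarrow> ('i \<times> 'k \<times> 'k \<Rightarrow> 'k::comm_ring_1) set" where
  "form_families I \<delta> = {w. (\<forall>i\<in>I. (\<lambda>x y. w (i, x, y)) \<in> binary_forms (\<delta> i)) \<and>
     (\<forall>i x y. i \<notin> I \<longrightarrow> w (i, x, y) = 0)}"

text \<open>A root of multiplicity above d/2, expressed by divisibility; the zero form has every u
  as such a root. Degree 0 is separate because the truncated difference would let multiples of
  \<open>br u\<close> pass, whereas among constants only 0 qualifies.\<close>

definition high_root :: "'k::comm_ring_1 \<times> 'k \<Rightarrow> nat \<Rightarrow> ('k \<Rightarrow> 'k \<Rightarrow> 'k) \<Rightarrow> bool" where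
  "high_root u d f \<longleftrightarrow> (if d = 0 then f = (\<lambda>x y. 0)
     else \<exists>g\<in>binary_forms (d - (d div 2 + 1)). f = (\<lambda>x y. br u (x, y) ^ (d div 2 + 1) * g x y))"

lemma Vspace_eq_form_families: "Vspace ds = form_families {..<length ds} ((!) ds)"
  by (auto simp: Vspace_def form_families_def)

lemma Vsum_eq_form_families:
  "(Vsum n ds :: ((nat \<times> nat) \<times> 'k \<times> 'k \<Rightarrow> 'k::comm_ring_1) set) =
     form_families ({..<n} \<times> {..<length ds}) (\<lambda>(t, i). ds ! i)"
proof (intro set_eqI iffI)
  fix w :: "(nat \<times> nat) \<times> 'k \<times> 'k \<Rightarrow> 'k"
  assume w: "w \<in> Vsum n ds"
  have "w ((t, i), x, y) = 0" if "\<not> (t < n \<and> i < length ds)" for t i x y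
    using w that by (cases "t < n") (auto simp: Vsum_def Vspace_def)
  with w show "w \<in> form_families ({..<n} \<times> {..<length ds}) (\<lambda>(t, i). ds ! i)"
    by (auto simp: Vsum_def Vspace_def form_families_def)
next
  fix w :: "(nat \<times> nat) \<times> 'k \<times> 'k \<Rightarrow> 'k"
  assume "w \<in> form_families ({..<n} \<times> {..<length ds}) (\<lambda>(t, i). ds ! i)"
  then show "w \<in> Vsum n ds"
    by (auto simp: Vsum_def Vspace_def form_families_def)
qed

lemma form_families_zero: "(\<lambda>_. 0) \<in> form_families I \<delta>"
  by (auto simp: form_families_def binary_forms_zero)

lemma form_families_add:
  "v \<in> form_families I \<delta> \<Longrightarrow> w \<in> form_families I \<delta> \<Longrightarrow> (\<lambda>z. v z + w z) \<in> form_families I \<delta>"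
  by (auto simp: form_families_def intro!: binary_forms_add)

lemma form_families_scale:
  "v \<in> form_families I \<delta> \<Longrightarrow> (\<lambda>z. a * v z) \<in> form_families I \<delta>"
  by (auto simp: form_families_def intro!: binary_forms_scale)

lemma form_families_sum:
  assumes "\<And>j. j \<in> J \<Longrightarrow> v j \<in> form_families I \<delta>"
  shows "(\<lambda>z. \<Sum>j\<in>J. v j z) \<in> form_families I \<delta>"
  using assms by (induction J rule: infinite_finite_induct)
    (auto intro: form_families_zero form_families_add)

lemma linear_on_form_families_sum:
  assumes L: "linear_on (form_families I \<delta>) L"
    and u: "\<And>j. j \<in> J \<Longrightarrow> u j \<in> form_families I \<delta>"
  shows "L (\<lambda>z. \<Sum>j\<in>J. a j * u j z) = (\<Sum>j\<in>J. a j * L (u j))"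
proof -
  have scale: "L (\<lambda>z. a * v z) = a * L v" if "v \<in> form_families I \<delta>" for a v
    using L that by (auto simp: linear_on_def)
  have add: "L (\<lambda>z. v z + v' z) = L v + L v'"
    if "v \<in> form_families I \<delta>" "v' \<in> form_families I \<delta>" for v v'
    using L that by (auto simp: linear_on_def)
  have zero: "L (\<lambda>z. 0) = 0"
    using scale[OF form_families_zero, of 0] by simp
  show ?thesis
    using u
  proof (induction J rule: infinite_finite_induct)
    case (insert j J)
    have "L (\<lambda>z. a j * u j z + (\<Sum>j\<in>J. a j * u j z)) = L (\<lambda>z. a j * u j z) + L (\<lambda>z. \<Sum>j\<in>J. a j * u j z)"
      using insert.prems by (intro add form_families_scale form_families_sum) auto
    with insert scale show ?case by simp
  qed (auto simp: zero)
qed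

section \<open>Polynomial functions along curves, and contraction to zero\<close>

lemma gen_alg_sum:
  assumes "\<And>i. i \<in> S \<Longrightarrow> f i \<in> gen_alg A"
  shows "(\<lambda>u. \<Sum>i\<in>S. f i u) \<in> gen_alg A"
  using assms by (induction S rule: infinite_finite_induct) (auto intro: gen_alg.intros)

lemma gen_alg_power: "f \<in> gen_alg A \<Longrightarrow> (\<lambda>u. f u ^ n) \<in> gen_alg A"
  by (induction n) (auto intro: gen_alg.intros)

text \<open>A polynomial function restricted to a polynomial curve is a univariate polynomial, so
  the limit s -> 0 becomes evaluation at 0.\<close>

lemma poly_funs_curve:
  fixes F :: "('i \<times> 'k \<times> 'k \<Rightarrow> 'k::comm_ring_1) \<Rightarrow> 'k"
  assumes "F \<in> poly_funs (form_families I \<delta>)" and u: "\<And>k. u k \<in> form_families I \<delta>"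
  obtains p where "\<And>s. F (\<lambda>z. \<Sum>k\<le>N. s ^ k * u k z) = poly p s"
proof -
  have "\<exists>p. \<forall>s. F (\<lambda>z. \<Sum>k\<le>N. s ^ k * u k z) = poly p s"
    using assms(1) unfolding poly_funs_def
  proof induction
    case (const c)
    show ?case by (intro exI[of _ "[:c:]"]) simp
  next
    case (gen L)
    then have "L (\<lambda>z. \<Sum>k\<le>N. s ^ k * u k z) = (\<Sum>k\<le>N. s ^ k * L (u k))" for s
      by (intro linear_on_form_families_sum) (auto simp: u)
    then show ?case
      by (intro exI[of _ "\<Sum>k\<le>N. monom (L (u k)) k"]) (simp add: poly_sum poly_monom mult.commute)
  next
    case (add f g)
    then show ?case by (metis poly_add)
  next
    case (mult f g)
    then show ?case by (metis poly_mult)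
  qed
  then show ?thesis using that by blast
qed

lemma poly_const_if_eventually:
  fixes p :: "'k::field_char_0 poly"
  assumes "\<And>s. s \<noteq> 0 \<Longrightarrow> poly p s = c"
  shows "poly p 0 = c"
proof -
  have "infinite (UNIV - {0::'k})" using infinite_UNIV_char_0 by simp
  moreover have "UNIV - {0} \<subseteq> {s. poly (p - [:c:]) s = 0}" using assms by auto
  ultimately have "infinite {s. poly (p - [:c:]) s = 0}" using infinite_super by blast
  then have "p - [:c:] = 0" using poly_roots_finite by blast
  then show ?thesis by simp
qed

text \<open>Moving u to a coordinate axis makes its linear form equal to y, so that the contracting
  subgroup can be taken diagonal.\<close>

lemma SL2_move_root:
  fixes u :: "'k::field \<times> 'k"
  assumes "u \<noteq> (0, 0)"
  shows "\<exists>a b c e. a * e - b * c = 1 \<and> (\<forall>x y. br u (e * x - b * y, - c * x + a * y) = y)"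
proof (cases "fst u = 0")
  case True
  with assms have "snd u \<noteq> 0" by (cases u) auto
  with True show ?thesis
    by (intro exI[of _ 0] exI[of _ "1 / snd u"] exI[of _ "- snd u"]) (auto simp: br_def field_simps)
next
  case False
  then show ?thesis
    by (intro exI[of _ "1 / fst u"] exI[of _ 0] exI[of _ "- snd u"] exI[of _ "fst u"]) (auto simp: br_def field_simps)
qed

text \<open>Once \<open>br u\<close> has become y, every monomial contains more factors y than x, so
  x -> x/s, y -> s y multiplies it by a positive power of s. Along this curve F is a polynomial in s
  that equals F w for s \<noteq> 0, hence also at s = 0, where the family is zero.\<close>

lemma invariants_vanish_if_common_high_root:
  fixes w :: "'i \<times> 'k \<times> 'k \<Rightarrow> 'k::field_char_0"
  assumes fin: "finite I" and w: "w \<in> form_families I \<delta>" and u: "u \<noteq> (0, 0)"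
    and high: "\<And>i. i \<in> I \<Longrightarrow> high_root u (\<delta> i) (\<lambda>x y. w (i, x, y))"
    and F: "F \<in> invariants (form_families I \<delta>)"
  shows "F w = F (\<lambda>_. 0)"
proof -
  obtain a b c e where det: "a * e - b * c = 1"
    and br: "\<And>x y. br u (e * x - b * y, - c * x + a * y) = y"
    using SL2_move_root[OF u] by (elim exE conjE) simp
  define q where "q i = \<delta> i - (\<delta> i div 2 + 1)" for i
  have "\<exists>k. \<forall>x y. w (i, e * x - b * y, - c * x + a * y) =
      (if \<delta> i = 0 then 0 else \<Sum>j\<le>q i. k j * x ^ (q i - j) * y ^ (j + (\<delta> i div 2 + 1)))" if i: "i \<in> I" for i
  proof (cases "\<delta> i = 0")
    case True
    then show ?thesis using high[OF i] by (auto simp: high_root_def fun_eq_iff)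
  next
    case False
    then obtain g where g: "g \<in> binary_forms (q i)"
      "\<And>x y. w (i, x, y) = br u (x, y) ^ (\<delta> i div 2 + 1) * g x y"
      using high[OF i] by (auto simp: high_root_def q_def fun_eq_iff)
    have "(\<lambda>x y. g (e * x - b * y) (- c * x + a * y)) \<in> binary_forms (q i)"
      using binary_forms_subst[OF g(1), of e "- b" "- c" a] by simp
    then obtain k where k: "\<And>x y. g (e * x - b * y) (- c * x + a * y) = (\<Sum>j\<le>q i. k j * x ^ (q i - j) * y ^ j)"
      unfolding binary_forms_def by blast
    have "w (i, e * x - b * y, - c * x + a * y) =
        (\<Sum>j\<le>q i. k j * x ^ (q i - j) * y ^ (j + (\<delta> i div 2 + 1)))" for x y
      unfolding g(2) br k sum_distrib_left by (intro sum.cong) (simp_all add: power_add mult_ac)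
    with False show ?thesis by auto
  qed
  then have "\<forall>i\<in>I. \<exists>k. \<forall>x y. w (i, e * x - b * y, - c * x + a * y) =
      (if \<delta> i = 0 then 0 else \<Sum>j\<le>q i. k j * x ^ (q i - j) * y ^ (j + (\<delta> i div 2 + 1)))"
    by blast
  from bchoice[OF this] obtain k where k: "\<And>i x y. i \<in> I \<Longrightarrow> w (i, e * x - b * y, - c * x + a * y) =
      (if \<delta> i = 0 then 0 else \<Sum>j\<le>q i. k i j * x ^ (q i - j) * y ^ (j + (\<delta> i div 2 + 1)))"
    by blast
  \<comment> \<open>The torus weight of the j-th monomial, that is, its y-degree minus its x-degree.
    \<open>U m\<close> below collects the part of weight m.\<close>
  define ex where "ex i j = 2 * j + 2 * (\<delta> i div 2 + 1) - \<delta> i" for i j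
  define U where "U m = (\<lambda>(i, x, y). if i \<in> I \<and> \<delta> i \<noteq> 0 then
      \<Sum>j\<le>q i. (if ex i j = m then k i j else 0) * x ^ (q i - j) * y ^ (j + (\<delta> i div 2 + 1)) else 0)" for m
  \<comment> \<open>A common bound for the weights, which are at most \<delta> i in component
    i.\<close>
  define N where "N = (\<Sum>i\<in>I. \<delta> i)"
  have U: "U m \<in> form_families I \<delta>" for m
    unfolding form_families_def
  proof (intro CollectI conjI ballI allI impI)
    fix i assume "i \<in> I"
    show "(\<lambda>x y. U m (i, x, y)) \<in> binary_forms (\<delta> i)"
    proof (cases "\<delta> i = 0")
      case True
      then show ?thesis by (simp add: U_def binary_forms_zero)
    next
      case False
      have "(\<lambda>x y. c * x ^ (q i - j) * y ^ (j + (\<delta> i div 2 + 1))) \<in> binary_forms (\<delta> i)"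
        if "j \<le> q i" for c j
      proof -
        have "q i - j = \<delta> i - (j + (\<delta> i div 2 + 1))" "j + (\<delta> i div 2 + 1) \<le> \<delta> i"
          using that False by (auto simp: q_def)
        then show ?thesis using binary_forms_monom[of "j + (\<delta> i div 2 + 1)" "\<delta> i" c] by simp
      qed
      then show ?thesis using \<open>i \<in> I\<close> False by (auto simp: U_def intro!: binary_forms_sum)
    qed
  qed (simp add: U_def)
  \<comment> \<open>No monomial has weight 0, because 2 (\<delta> i div 2 + 1) exceeds \<delta>
    i.\<close>
  have U0: "U 0 = (\<lambda>_. 0)"
    by (auto simp: U_def ex_def fun_eq_iff intro!: sum.neutral)
  obtain p where p: "\<And>s. F (\<lambda>z. \<Sum>m\<le>N. s ^ m * U m z) = poly p s"
    using poly_funs_curve[of F I \<delta> U N] F U by (auto simp: invariants_def)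
  have "poly p s = F w" if "s \<noteq> 0" for s
  proof -
    \<comment> \<open>The product of diag(s, 1/s) with the matrix that moves u.\<close>
    define g where "g = (s * a, s * b, c / s, e / s)"
    have "g \<in> SL2" using det that by (auto simp: SL2_def g_def)
    moreover have "sl2_act g w = (\<lambda>z. \<Sum>m\<le>N. s ^ m * U m z)"
    proof (intro ext, safe)
      fix i x y
      have *: "sl2_act g w (i, x, y) =
         w (i, e * (x / s) - b * (s * y), - c * (x / s) + a * (s * y))"
        by (simp add: sl2_act_def g_def mult_ac)
      show "sl2_act g w (i, x, y) = (\<Sum>m\<le>N. s ^ m * U m (i, x, y))"
      proof (cases "i \<in> I \<and> \<delta> i \<noteq> 0")
        case False
        then have "sl2_act g w (i, x, y) = 0"
          unfolding * using w k[of i "x / s" "s * y"]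
          by (cases "i \<in> I") (auto simp del: times_divide_eq_right simp: form_families_def)
        then show ?thesis using False by (auto simp: U_def)
      next
        case True
        have "\<delta> i \<le> N" unfolding N_def using True fin by (intro member_le_sum) auto
        have "(\<Sum>m\<le>N. s ^ m * U m (i, x, y)) = (\<Sum>j\<le>q i. \<Sum>m\<le>N.
            s ^ m * ((if ex i j = m then k i j else 0) * x ^ (q i - j) * y ^ (j + (\<delta> i div 2 + 1))))"
          unfolding U_def using True by (subst sum.swap) (auto simp: sum_distrib_left)
        also have "\<dots> = (\<Sum>j\<le>q i. s ^ ex i j * (k i j * x ^ (q i - j) * y ^ (j + (\<delta> i div 2 + 1))))"
        proof (intro sum.cong refl)
          fix j assume "j \<in> {..q i}"
          then have "ex i j \<in> {..N}" using \<open>\<delta> i \<le> N\<close> True by (auto simp: ex_def q_def)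
          have "(\<Sum>m\<le>N. s ^ m * ((if ex i j = m then k i j else 0) * x ^ (q i - j) * y ^ (j + (\<delta> i div 2 + 1))))
            = (\<Sum>m\<le>N. if ex i j = m then s ^ m * (k i j * x ^ (q i - j) * y ^ (j + (\<delta> i div 2 + 1))) else 0)"
            by (intro sum.cong) auto
          then show "(\<Sum>m\<le>N. s ^ m * ((if ex i j = m then k i j else 0) * x ^ (q i - j) * y ^ (j + (\<delta> i div 2 + 1))))
            = s ^ ex i j * (k i j * x ^ (q i - j) * y ^ (j + (\<delta> i div 2 + 1)))"
            using \<open>ex i j \<in> {..N}\<close> by (simp add: sum.delta)
        qed
        also have "\<dots> = (\<Sum>j\<le>q i. k i j * (x / s) ^ (q i - j) * (s * y) ^ (j + (\<delta> i div 2 + 1)))"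
        proof (intro sum.cong refl)
          fix j assume "j \<in> {..q i}"
          then have "j + (\<delta> i div 2 + 1) = (q i - j) + ex i j"
            using True by (auto simp: ex_def q_def)
          then have "s ^ (j + (\<delta> i div 2 + 1)) = s ^ (q i - j) * s ^ ex i j"
            by (metis power_add)
          then show "s ^ ex i j * (k i j * x ^ (q i - j) * y ^ (j + (\<delta> i div 2 + 1)))
             = k i j * (x / s) ^ (q i - j) * (s * y) ^ (j + (\<delta> i div 2 + 1))"
            unfolding power_mult_distrib power_divide using that by (simp add: field_simps)
        qed
        also have "\<dots> = sl2_act g w (i, x, y)"
          unfolding * using True k[of i "x / s" "s * y"] by (simp only: if_False)
        finally show ?thesis by simp
      qed
    qed
    ultimately show ?thesis using F w p[of s] unfolding invariants_def by force
  qed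
  then have "poly p 0 = F w" by (rule poly_const_if_eventually)
  moreover have "(\<lambda>z. \<Sum>m\<le>N. 0 ^ m * U m z) = (\<lambda>_. 0)"
    using U0 by (auto simp: fun_eq_iff power_0_left intro!: sum.neutral)
  ultimately show ?thesis using p[of 0] by simp
qed

section \<open>Symmetrized brackets as polynomials in the coefficients\<close>

lemma prod_lessThan_add:
  "(\<Prod>i<m + n. f i) = (\<Prod>i<m. f i) * (\<Prod>i<n. f (m + i))" for f :: "nat \<Rightarrow> 'a::comm_monoid_mult"
  by (induction n) (simp_all add: mult.assoc)

lemma alternating_sum_supersets:
  assumes "finite I" "T \<subseteq> I"
  shows "(\<Sum>S\<in>{S\<in>Pow I. T \<subseteq> S}. (-1) ^ card S :: 'a::comm_ring_1) = (if T = I then (-1) ^ card I else 0)"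
proof (cases "T = I")
  case True
  then have "{S\<in>Pow I. T \<subseteq> S} = {I}" by auto
  with True show ?thesis by simp
next
  case False
  let ?P = "{S\<in>Pow I. T \<subseteq> S}"
  have fin: "finite ?P" using assms by auto
  have "T \<subset> I" using False assms by auto
  from card_subsupersets_even_odd[OF assms(1) this]
  have eq: "card {S\<in>?P. even (card S)} = card {S\<in>?P. odd (card S)}"
    by (simp add: conj_ac)
  have "(\<Sum>S\<in>?P. (-1) ^ card S :: 'a) = 0"
    using sum_alternating_cancels[OF fin eq] by simp
  then show ?thesis using False by simp
qed

text \<open>Expanding the products of row sums gives a sum over maps from I to S.
  Inclusion-exclusion over S keeps the maps whose image is all of I, and on a finite set these are
  the permutations.\<close>

lemma permanent_ryser:
  fixes A :: "'i \<Rightarrow> 'i \<Rightarrow> 'a::comm_ring_1"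
  assumes fin: "finite I"
  shows "(\<Sum>\<sigma> | \<sigma> permutes I. \<Prod>i\<in>I. A i (\<sigma> i)) =
    (-1) ^ card I * (\<Sum>S\<in>Pow I. (-1) ^ card S * (\<Prod>i\<in>I. \<Sum>j\<in>S. A i j))"
proof -
  let ?F = "PiE I (\<lambda>_. I)"
  have finF: "finite ?F" using fin by (intro finite_PiE) auto
  have "(\<Sum>S\<in>Pow I. (-1) ^ card S * (\<Prod>i\<in>I. \<Sum>j\<in>S. A i j))
    = (\<Sum>S\<in>Pow I. \<Sum>f\<in>PiE I (\<lambda>_. S). (-1) ^ card S * (\<Prod>i\<in>I. A i (f i)))"
    using fin by (intro sum.cong refl, subst prod_sum_PiE) (auto simp: sum_distrib_left intro: finite_subset)
  also have "\<dots> = (\<Sum>S\<in>Pow I. \<Sum>f\<in>{f\<in>?F. f ` I \<subseteq> S}. (-1) ^ card S * (\<Prod>i\<in>I. A i (f i)))"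
    by (intro sum.cong refl) (auto simp: PiE_def Pi_def extensional_def image_subset_iff)
  also have "\<dots> = (\<Sum>f\<in>?F. \<Sum>S\<in>{S\<in>Pow I. f ` I \<subseteq> S}. (-1) ^ card S * (\<Prod>i\<in>I. A i (f i)))"
    using fin finF by (intro sum.swap_restrict) auto
  also have "\<dots> = (\<Sum>f\<in>?F. if f ` I = I then (-1) ^ card I * (\<Prod>i\<in>I. A i (f i)) else 0)"
  proof (intro sum.cong refl)
    fix f assume "f \<in> ?F"
    then have "f ` I \<subseteq> I" by auto
    then show "(\<Sum>S\<in>{S\<in>Pow I. f ` I \<subseteq> S}. (-1) ^ card S * (\<Prod>i\<in>I. A i (f i)))
      = (if f ` I = I then (-1) ^ card I * (\<Prod>i\<in>I. A i (f i)) else 0)"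
      unfolding sum_distrib_right[symmetric] by (subst alternating_sum_supersets[OF fin]) auto
  qed
  also have "\<dots> = (\<Sum>f\<in>{f\<in>?F. f ` I = I}. (-1) ^ card I * (\<Prod>i\<in>I. A i (f i)))"
    using finF by (simp add: sum.inter_filter)
  also have "\<dots> = (\<Sum>\<sigma> | \<sigma> permutes I. (-1) ^ card I * (\<Prod>i\<in>I. A i (\<sigma> i)))"
  proof (intro sum.reindex_bij_witness[where i = "\<lambda>\<sigma>. restrict \<sigma> I" and j = "\<lambda>f x. if x \<in> I then f x else x"])
    fix f assume f: "f \<in> {f\<in>?F. f ` I = I}"
    then show "restrict (\<lambda>x. if x \<in> I then f x else x) I = f"
      by (auto simp: fun_eq_iff PiE_def extensional_def)
    have "inj_on f I" using f fin by (simp add: eq_card_imp_inj_on)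
    with f have "bij_betw f I I" by (auto simp: bij_betw_def)
    then have "bij_betw (\<lambda>x. if x \<in> I then f x else x) I I"
      by (rule bij_betw_cong[THEN iffD1, rotated]) auto
    then show "(\<lambda>x. if x \<in> I then f x else x) \<in> {\<sigma>. \<sigma> permutes I}"
      by (auto intro!: bij_imp_permutes)
  next
    fix \<sigma> assume "\<sigma> \<in> {\<sigma>. \<sigma> permutes I}"
    then have \<sigma>: "\<sigma> permutes I" by simp
    show "(\<lambda>x. if x \<in> I then restrict \<sigma> I x else x) = \<sigma>"
      using \<sigma> by (auto simp: fun_eq_iff permutes_not_in)
    show "restrict \<sigma> I \<in> {f\<in>?F. f ` I = I}"
      using permutes_image[OF \<sigma>] by auto
  qed auto
  finally show ?thesis
    by (simp add: sum_distrib_left[symmetric] mult.assoc[symmetric] power_mult_distrib[symmetric])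
qed

text \<open>A permanent does not change under transposition. If the entry in row j and column i is
  the value of form j at point i, each inner sum is now the value of one single form at point
  i.\<close>

lemma permanent_ryser_transpose:
  fixes A :: "'i \<Rightarrow> 'i \<Rightarrow> 'a::comm_ring_1"
  assumes fin: "finite I"
  shows "(\<Sum>\<sigma> | \<sigma> permutes I. \<Prod>i\<in>I. A i (\<sigma> i)) =
    (-1) ^ card I * (\<Sum>S\<in>Pow I. (-1) ^ card S * (\<Prod>i\<in>I. \<Sum>j\<in>S. A j i))"
proof -
  have "(\<Sum>\<sigma> | \<sigma> permutes I. \<Prod>i\<in>I. A i (\<sigma> i)) = (\<Sum>\<sigma> | \<sigma> permutes I. \<Prod>i\<in>I. A (\<sigma> i) i)"
  proof (rule sum.reindex_bij_witness[where i = inv and j = inv])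
    fix \<sigma> assume "\<sigma> \<in> {\<sigma>. \<sigma> permutes I}"
    then have \<sigma>: "\<sigma> permutes I" by simp
    show "inv (inv \<sigma>) = \<sigma>" by (rule permutes_inv_inv[OF \<sigma>])
    show "inv \<sigma> \<in> {\<sigma>. \<sigma> permutes I}" using permutes_inv[OF \<sigma>] by simp
    show "(\<Prod>i\<in>I. A (inv \<sigma> i) i) = (\<Prod>i\<in>I. A i (\<sigma> i))"
      by (subst prod.permute[OF \<sigma>]) (simp add: permutes_inverses[OF \<sigma>])
  next
    fix \<sigma> assume "\<sigma> \<in> {\<sigma>. \<sigma> permutes I}"
    then have \<sigma>: "\<sigma> permutes I" by simp
    show "inv (inv \<sigma>) = \<sigma>" by (rule permutes_inv_inv[OF \<sigma>])
    show "inv \<sigma> \<in> {\<sigma>. \<sigma> permutes I}" using permutes_inv[OF \<sigma>] by simp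
  qed
  then show ?thesis using permanent_ryser[OF fin, of "\<lambda>i j. A j i"] by simp
qed

text \<open>If M s were nonzero, take a polynomial P without constant term that vanishes at all
  other values of M but not at M s. The sum of P over the family is a combination of power sums,
  hence 0, yet it equals P (M s) times a positive multiplicity, which is nonzero in characteristic
  0.\<close>

lemma power_sums_zero_imp_zero:
  fixes M :: "'s \<Rightarrow> 'k::field_char_0"
  assumes fin: "finite S" and sums: "\<And>N. 0 < N \<Longrightarrow> (\<Sum>s\<in>S. M s ^ N) = 0" and "s \<in> S"
  shows "M s = 0"
proof (rule ccontr)
  assume nz: "M s \<noteq> 0"
  \<comment> \<open>The factor X removes the constant term, so that only exponents N > 0
    enter.\<close>
  define P where "P = [:0, 1:] * (\<Prod>v\<in>M ` S - {M s}. [:- v, 1:])"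
  have "(\<Sum>t\<in>S. poly P (M t)) = (\<Sum>t\<in>S. \<Sum>j\<le>degree P. coeff P j * M t ^ j)"
    by (simp add: poly_altdef)
  also have "\<dots> = (\<Sum>j\<le>degree P. coeff P j * (\<Sum>t\<in>S. M t ^ j))"
    by (subst sum.swap) (simp add: sum_distrib_left)
  also have "\<dots> = 0"
  proof (intro sum.neutral ballI)
    fix j
    have "coeff P 0 = 0" by (simp add: P_def)
    then show "coeff P j * (\<Sum>t\<in>S. M t ^ j) = 0" using sums[of j] by (cases "j = 0") auto
  qed
  finally have 0: "(\<Sum>t\<in>S. poly P (M t)) = 0" .
  have "poly P (M t) = (if M t = M s then poly P (M s) else 0)" if "t \<in> S" for t
    using that fin by (auto simp: P_def poly_prod)
  then have "(\<Sum>t\<in>S. poly P (M t)) = (\<Sum>t\<in>S. if M t = M s then poly P (M s) else 0)"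
    by (intro sum.cong) auto
  also have "\<dots> = of_nat (card {t\<in>S. M t = M s}) * poly P (M s)"
    using fin by (simp add: sum.inter_filter[symmetric])
  finally have "of_nat (card {t\<in>S. M t = M s}) * poly P (M s) = 0" using 0 by simp
  moreover have "card {t\<in>S. M t = M s} \<noteq> 0" using fin \<open>s \<in> S\<close> by auto
  moreover have "poly P (M s) \<noteq> 0" using nz fin by (auto simp: P_def poly_prod)
  ultimately show False by simp
qed

text \<open>Point evaluations take the place of coefficients: they are linear in h, and under h =
  v_i^a v_j^b they pull back to polynomials in values of v_i and v_j.\<close>

definition eval_alg :: "(('k \<Rightarrow> 'k \<Rightarrow> 'k::comm_ring_1) \<Rightarrow> 'k) set" where
  "eval_alg = gen_alg {\<lambda>h. h x y | x y. True}"

text \<open>The N-th power sum of the bracket products over all matchings k -- m + k of the permuted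
  factors. For odd N and m > 0 swapping one pair cancels it, so the exponents N have to be used
  together.\<close>

definition matching_sum :: "nat \<Rightarrow> nat \<Rightarrow> (nat \<Rightarrow> 'k::comm_ring_1 \<times> 'k) \<Rightarrow> 'k" where
  "matching_sum N m l = (\<Sum>\<sigma> | \<sigma> permutes {..<m + m}. (\<Prod>k<m. br (l (\<sigma> k)) (l (\<sigma> (m + k)))) ^ N)"

lemma br_neg: "br v (- fst u, - snd u) = br u v"
  by (simp add: br_def)

context
  assumes alg_closed: "\<forall>p :: 'k::field_char_0 poly. 0 < degree p \<longrightarrow> (\<exists>x. poly p x = 0)"
begin

text \<open>A form H splits as a product of linear forms, so its product over the roots of h is the
  product of the values of h at the roots of H.\<close>
lemma symmetrized_forms_in_eval_alg:
  fixes w :: "nat \<Rightarrow> 'k \<Rightarrow> 'k \<Rightarrow> 'k"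
  assumes w: "\<And>i. i < n \<Longrightarrow> w i \<in> binary_forms N" and "0 < N"
  shows "\<exists>G\<in>eval_alg. \<forall>l. (\<Sum>\<sigma> | \<sigma> permutes {..<n}. \<Prod>i<n. w i (fst (l (\<sigma> i))) (snd (l (\<sigma> i))))
       = G (\<lambda>x y. \<Prod>i<n. br (l i) (x, y))"
proof -
  have "\<exists>ls. (\<lambda>x y. \<Sum>j\<in>S. w j x y) = br_prod ls" if S: "S \<in> Pow {..<n}" for S
  proof -
    have "(\<lambda>x y. \<Sum>j\<in>S. w j x y) \<in> binary_forms N" using S by (intro binary_forms_sum w) auto
    from binary_forms_split[OF alg_closed this \<open>0 < N\<close>] show ?thesis by blast
  qed
  then have "\<forall>S\<in>Pow {..<n}. \<exists>ls. (\<lambda>x y. \<Sum>j\<in>S. w j x y) = br_prod ls" by blast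
  from bchoice[OF this] obtain ls
    where ls: "\<And>S. S \<in> Pow {..<n} \<Longrightarrow> (\<lambda>x y. \<Sum>j\<in>S. w j x y) = br_prod (ls S)" by blast
  \<comment> \<open>\<open>ls S\<close> lists the roots of the form H that is the sum of the w j
    over S. The product of H over the points l i equals the product of h over the negated roots
    \<rho>; the negation accounts for the antisymmetry of the bracket.\<close>
  define G where "G = (\<lambda>h :: 'k \<Rightarrow> 'k \<Rightarrow> 'k. (-1) ^ n * (\<Sum>S\<in>Pow {..<n}. (-1) ^ card S *
     (\<Prod>\<rho>\<leftarrow>ls S. h (- fst \<rho>) (- snd \<rho>))))"
  have prod: "(\<lambda>h. \<Prod>\<rho>\<leftarrow>xs. h (- fst \<rho>) (- snd \<rho>)) \<in> eval_alg" for xs :: "('k \<times> 'k) list"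
  proof (induction xs)
    case Nil
    show ?case unfolding eval_alg_def using gen_alg.const[of 1] by simp
  next
    case (Cons \<rho> xs)
    have "(\<lambda>h. h (- fst \<rho>) (- snd \<rho>)) \<in> gen_alg {\<lambda>h :: 'k \<Rightarrow> 'k \<Rightarrow> 'k. h x y | x y. True}"
      by (rule gen_alg.gen) auto
    from gen_alg.mult[OF this Cons.IH[unfolded eval_alg_def]] show ?case
      by (simp add: eval_alg_def)
  qed
  have "G \<in> eval_alg"
    unfolding G_def eval_alg_def
    by (intro gen_alg.mult gen_alg_sum gen_alg.const prod[unfolded eval_alg_def])
  moreover have "(\<Sum>\<sigma> | \<sigma> permutes {..<n}. \<Prod>i<n. w i (fst (l (\<sigma> i))) (snd (l (\<sigma> i))))
       = G (\<lambda>x y. \<Prod>i<n. br (l i) (x, y))" for l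
  proof -
    have 1: "(\<Prod>i<n. \<Prod>\<rho>\<leftarrow>xs. br \<rho> (l i)) = (\<Prod>\<rho>\<leftarrow>xs. \<Prod>i<n. br (l i) (- fst \<rho>, - snd \<rho>))" for xs
      by (induction xs) (simp_all add: prod.distrib br_neg)
    have "(\<Prod>i<n. \<Sum>j\<in>S. w j (fst (l i)) (snd (l i))) =
        (\<Prod>\<rho>\<leftarrow>ls S. \<Prod>i<n. br (l i) (- fst \<rho>, - snd \<rho>))" if "S \<in> Pow {..<n}" for S
    proof -
      have "(\<Sum>j\<in>S. w j (fst (l i)) (snd (l i))) = (\<Prod>\<rho>\<leftarrow>ls S. br \<rho> (l i))" for i
        using fun_cong[OF fun_cong[OF ls[OF that]], of "fst (l i)" "snd (l i)"] by (simp add: br_prod_def)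
      then show ?thesis by (simp only: 1)
    qed
    then show ?thesis
      using permanent_ryser_transpose[of "{..<n}" "\<lambda>i j. w i (fst (l j)) (snd (l j))"]
      by (simp add: G_def)
  qed
  ultimately show ?thesis by blast
qed

text \<open>The binomial theorem, applied to each bracket power, separates the variables: every term
  is a product of one monomial of degree N per point, to which
  \<open>symmetrized_forms_in_eval_alg\<close> applies.\<close>

lemma matching_sum_in_eval_alg:
  assumes "0 < N"
  shows "\<exists>G\<in>eval_alg. \<forall>l :: nat \<Rightarrow> 'k \<times> 'k. matching_sum N m l = G (\<lambda>x y. \<Prod>i<m + m. br (l i) (x, y))"
proof -
  let ?K = "PiE {..<m} (\<lambda>_. {..N})"
  \<comment> \<open>\<kappa> selects a binomial term for each pair. The first partner carries the
    coefficient and sign, the second the complementary exponents.\<close>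
  define W where "W \<kappa> i x y = (if i < m then of_nat (N choose \<kappa> i) * (- 1) ^ (N - \<kappa> i) * x ^ \<kappa> i * y ^ (N - \<kappa> i)
      else x ^ (N - \<kappa> (i - m)) * y ^ \<kappa> (i - m))" for \<kappa> :: "nat \<Rightarrow> nat" and i and x y :: 'k
  have W: "W \<kappa> i \<in> binary_forms N" if "\<kappa> \<in> ?K" "i < m + m" for \<kappa> i
  proof (cases "i < m")
    case True
    then have "\<kappa> i \<le> N" using that by auto
    then show ?thesis using True
      binary_forms_monom[of "N - \<kappa> i" N "of_nat (N choose \<kappa> i) * (- 1) ^ (N - \<kappa> i)"]
      by (simp add: W_def[abs_def])
  next
    case False
    then have "i - m \<in> {..<m}" using that by auto
    then have "\<kappa> (i - m) \<le> N" using that by auto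
    then show ?thesis using False binary_forms_monom[of "\<kappa> (i - m)" N 1]
      by (simp add: W_def[abs_def])
  qed
  have "\<forall>\<kappa>\<in>?K. \<exists>G. G \<in> eval_alg \<and> (\<forall>l. (\<Sum>\<sigma> | \<sigma> permutes {..<m + m}. \<Prod>i<m + m. W \<kappa> i (fst (l (\<sigma> i))) (snd (l (\<sigma> i))))
       = G (\<lambda>x y. \<Prod>i<m + m. br (l i) (x, y)))"
  proof
    fix \<kappa> assume "\<kappa> \<in> ?K"
    from symmetrized_forms_in_eval_alg[OF W[OF this] \<open>0 < N\<close>]
    show "\<exists>G. G \<in> eval_alg \<and> (\<forall>l. (\<Sum>\<sigma> | \<sigma> permutes {..<m + m}. \<Prod>i<m + m. W \<kappa> i (fst (l (\<sigma> i))) (snd (l (\<sigma> i))))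
       = G (\<lambda>x y. \<Prod>i<m + m. br (l i) (x, y)))"
      by (simp add: Bex_def)
  qed
  from bchoice[OF this] obtain G where G: "\<And>\<kappa>. \<kappa> \<in> ?K \<Longrightarrow> G \<kappa> \<in> eval_alg"
    "\<And>\<kappa> l. \<kappa> \<in> ?K \<Longrightarrow> (\<Sum>\<sigma> | \<sigma> permutes {..<m + m}. \<Prod>i<m + m. W \<kappa> i (fst (l (\<sigma> i))) (snd (l (\<sigma> i))))
       = G \<kappa> (\<lambda>x y. \<Prod>i<m + m. br (l i) (x, y))" by blast
  have expand: "(\<Prod>k<m. br (l k) (l (m + k))) ^ N = (\<Sum>\<kappa>\<in>?K. \<Prod>i<m + m. W \<kappa> i (fst (l i)) (snd (l i)))"
    for l :: "nat \<Rightarrow> 'k \<times> 'k"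
  proof -
    have "br u v ^ N = (\<Sum>j\<le>N. of_nat (N choose j) * (- 1) ^ (N - j) * fst u ^ j * snd u ^ (N - j) *
        (fst v ^ (N - j) * snd v ^ j))" for u v :: "'k \<times> 'k"
    proof -
      have "br u v ^ N = (fst u * snd v + (- 1) * (snd u * fst v)) ^ N" by (simp add: br_def)
      then show ?thesis unfolding binomial_ring power_mult_distrib by (simp add: mult_ac)
    qed
    then have "(\<Prod>k<m. br (l k) (l (m + k))) ^ N = (\<Prod>k<m. \<Sum>j\<in>{..N}. of_nat (N choose j) * (- 1) ^ (N - j) * fst (l k) ^ j * snd (l k) ^ (N - j) *
        (fst (l (m + k)) ^ (N - j) * snd (l (m + k)) ^ j))"
      by (simp add: prod_power_distrib)
    also have "\<dots> = (\<Sum>\<kappa>\<in>?K. \<Prod>k<m. of_nat (N choose \<kappa> k) * (- 1) ^ (N - \<kappa> k) * fst (l k) ^ \<kappa> k * snd (l k) ^ (N - \<kappa> k) *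
        (fst (l (m + k)) ^ (N - \<kappa> k) * snd (l (m + k)) ^ \<kappa> k))"
      by (rule prod_sum_PiE) auto
    also have "\<dots> = (\<Sum>\<kappa>\<in>?K. \<Prod>i<m + m. W \<kappa> i (fst (l i)) (snd (l i)))"
      by (intro sum.cong refl) (simp add: prod_lessThan_add prod.distrib[symmetric] W_def)
    finally show ?thesis .
  qed
  have "(\<lambda>h. \<Sum>\<kappa>\<in>?K. G \<kappa> h) \<in> eval_alg"
    unfolding eval_alg_def by (rule gen_alg_sum) (use G in \<open>simp add: eval_alg_def\<close>)
  moreover have "matching_sum N m l = (\<Sum>\<kappa>\<in>?K. G \<kappa> (\<lambda>x y. \<Prod>i<m + m. br (l i) (x, y)))" for l
  proof -
    have "matching_sum N m l = (\<Sum>\<sigma> | \<sigma> permutes {..<m + m}. \<Sum>\<kappa>\<in>?K. \<Prod>i<m + m. W \<kappa> i (fst (l (\<sigma> i))) (snd (l (\<sigma> i))))"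
      unfolding matching_sum_def by (intro sum.cong refl expand)
    also have "\<dots> = (\<Sum>\<kappa>\<in>?K. G \<kappa> (\<lambda>x y. \<Prod>i<m + m. br (l i) (x, y)))"
      by (subst sum.swap) (simp add: G(2))
    finally show ?thesis .
  qed
  ultimately show ?thesis
    by (intro bexI[of _ "\<lambda>h. \<Sum>\<kappa>\<in>?K. G \<kappa> h"]) auto
qed

end

section \<open>The nullcone criterion\<close>

definition root_count :: "('k::comm_ring_1 \<times> 'k) list \<Rightarrow> 'k \<times> 'k \<Rightarrow> nat" where
  "root_count ls u = length (filter (\<lambda>l. br l u = 0) ls)"

lemma root_count_append: "root_count (ls @ ls') u = root_count ls u + root_count ls' u"
  by (simp add: root_count_def)

lemma root_count_concat_replicate: "root_count (concat (replicate a ls)) u = a * root_count ls u"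
  by (induction a) (auto simp: root_count_def)

lemma br_prod_append: "br_prod (ls @ ls') x y = br_prod ls x y * br_prod ls' x y"
  by (simp add: br_prod_def)

lemma br_prod_concat_replicate: "br_prod (concat (replicate a ls)) x y = br_prod ls x y ^ a"
  by (induction a) (auto simp: br_prod_def)

lemma br_prod_nth: "br_prod ls x y = (\<Prod>i<length ls. br (ls ! i) (x, y))"
  by (simp add: br_prod_def prod.list_conv_set_nth atLeast0LessThan)

lemma br_commute_zero: "br u v = 0 \<longleftrightarrow> br v u = 0"
  by (auto simp: br_def mult.commute)

lemma br_self: "br u u = 0"
  by (simp add: br_def mult.commute)

lemma br_zero_left: "br (0, 0) u = 0"
  by (simp add: br_def)

lemma br_zero_trans:
  fixes u :: "'k::field \<times> 'k"
  assumes "u \<noteq> (0, 0)" "br a u = 0" "br b u = 0"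
  shows "br a b = 0"
proof -
  obtain p q where u: "u = (p, q)" by (cases u)
  have 1: "fst a * q = snd a * p" "fst b * q = snd b * p" using assms by (auto simp: br_def u)
  have "p * br a b = 0" "q * br a b = 0"
    using 1 by (simp_all add: br_def right_diff_distrib) algebra+
  then show ?thesis using assms(1) u by auto
qed

lemma br_zero_scale:
  fixes u :: "'k::field \<times> 'k"
  assumes "u \<noteq> (0, 0)" "br l u = 0"
  shows "\<exists>t. \<forall>v. br l v = t * br u v"
proof (cases "fst u = 0")
  case True
  with assms show ?thesis
    by (intro exI[of _ "snd l / snd u"]) (cases u, auto simp: br_def field_simps)
next
  case False
  with assms show ?thesis
    by (intro exI[of _ "fst l / fst u"]) (auto simp: br_def field_simps)
qed

lemma root_count_cong:
  fixes u :: "'k::field \<times> 'k"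
  assumes "u \<noteq> (0, 0)" "v \<noteq> (0, 0)" "br u v = 0"
  shows "root_count ls u = root_count ls v"
proof -
  have "br l u = 0 \<longleftrightarrow> br l v = 0" for l
    using assms br_zero_trans[of u l v] br_zero_trans[of v l u] br_commute_zero[of u v] by auto
  then show ?thesis by (simp add: root_count_def)
qed

text \<open>A nonzero linear form does not vanish at two non-proportional points, so disjoint sets
  of factors are counted. Hence at most one root can have more than half of the factors.\<close>

lemma root_count_add_le:
  fixes u :: "'k::field \<times> 'k"
  assumes "br u v \<noteq> 0" "(0, 0) \<notin> set ls"
  shows "root_count ls u + root_count ls v \<le> length ls"
proof -
  have "\<not> (br l u = 0 \<and> br l v = 0)" if "l \<in> set ls" for l
    using assms that br_zero_trans[of l u v] br_commute_zero[of l] by auto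
  then have "root_count ls u \<le> length (filter (\<lambda>l. \<not> br l v = 0) ls)"
    unfolding root_count_def by (induction ls) (auto simp: le_Suc_eq)
  then show ?thesis using sum_length_filter_compl[of "\<lambda>l. br l v = 0" ls] by (simp add: root_count_def)
qed

lemma high_root_br_prod:
  fixes u :: "'k::field \<times> 'k"
  assumes u: "u \<noteq> (0, 0)" and d: "0 < d" "length ls = d" and count: "d < 2 * root_count ls u"
  shows "high_root u d (br_prod ls)"
proof -
  let ?Z = "filter (\<lambda>l. br l u = 0) ls" and ?N = "filter (\<lambda>l. br l u \<noteq> 0) ls"
  define p where "p = d div 2 + 1"
  have "\<exists>t. \<forall>x y. br_prod xs x y = t * br u (x, y) ^ length xs"
    if "\<And>l. l \<in> set xs \<Longrightarrow> br l u = 0" for xs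
    using that
  proof (induction xs)
    case Nil
    show ?case by (auto simp: br_prod_def)
  next
    case (Cons l xs)
    obtain t s where "\<forall>x y. br_prod xs x y = t * br u (x, y) ^ length xs" "\<forall>v. br l v = s * br u v"
      using Cons br_zero_scale[OF u, of l] by auto
    then show ?case by (intro exI[of _ "s * t"]) (simp add: br_prod_def mult_ac)
  qed
  from this[of ?Z] obtain t where t: "\<And>x y. br_prod ?Z x y = t * br u (x, y) ^ length ?Z" by auto
  have len: "length ?Z + length ?N = d" using sum_length_filter_compl[of "\<lambda>l. br l u = 0" ls] d by simp
  have p: "p \<le> length ?Z" using count by (simp add: root_count_def p_def)
  define g where "g x y = t * (br u (x, y) ^ (length ?Z - p) * br_prod ?N x y)" for x y
  have split: "br_prod xs x y = br_prod (filter P xs) x y * br_prod (filter (\<lambda>l. \<not> P l) xs) x y" for P xs x y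
    by (induction xs) (auto simp: br_prod_def)
  have "br_prod ls x y = br u (x, y) ^ p * g x y" for x y
    using p unfolding split[of ls x y "\<lambda>l. br l u = 0"] t g_def
    by (simp add: mult_ac power_add[symmetric])
  moreover have "g \<in> binary_forms (d - p)"
  proof -
    have "(length ?Z - p) * 1 + length ?N = d - p" using len p by simp
    moreover have "(\<lambda>x y. br u (x, y) ^ (length ?Z - p) * br_prod ?N x y)
        \<in> binary_forms ((length ?Z - p) * 1 + length ?N)"
      by (intro binary_forms_mult binary_forms_power binary_forms_br binary_forms_br_prod)
    ultimately show ?thesis unfolding g_def[abs_def] by (intro binary_forms_scale) simp
  qed
  ultimately show ?thesis using d by (auto simp: high_root_def p_def fun_eq_iff intro!: bexI[of _ g])
qed

text \<open>After sorting by proportionality class, entries at distance m cannot be proportional, as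
  otherwise their class would have more than m members.\<close>
lemma ex_matching:
  fixes ls :: "('k::field \<times> 'k) list"
  assumes len: "length ls = m + m" and nz: "(0, 0) \<notin> set ls"
    and count: "\<And>u. u \<noteq> (0, 0) \<Longrightarrow> root_count ls u \<le> m"
  shows "\<exists>ls'. mset ls' = mset ls \<and> (\<forall>k<m. br (ls' ! k) (ls' ! (m + k)) \<noteq> 0)"
proof -
  \<comment> \<open>The position of the first proportional entry labels the proportionality class by
    a natural number, which makes sorting possible.\<close>
  define key where "key l = (LEAST i. i < length ls \<and> br (ls ! i) l = 0)" for l
  have key: "key l < length ls \<and> br (ls ! key l) l = 0" if "l \<in> set ls" for l
  proof -
    have "\<exists>i. i < length ls \<and> br (ls ! i) l = 0" using that by (auto simp: in_set_conv_nth br_self)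
    then show ?thesis unfolding key_def by (rule LeastI_ex)
  qed
  have key_eq: "key l = key l'" if "l \<in> set ls" "l' \<in> set ls" "br l l' = 0" for l l'
  proof -
    have "l \<noteq> (0, 0)" "l' \<noteq> (0, 0)" using that nz by auto
    then have "br v l = 0 \<longleftrightarrow> br v l' = 0" for v
      using that(3) br_zero_trans[of l v l'] br_zero_trans[of l' v l] br_commute_zero[of l l'] by auto
    then show ?thesis by (simp add: key_def)
  qed
  have eq_key: "br l l' = 0" if "l \<in> set ls" "l' \<in> set ls" "key l = key l'" for l l'
    using key[OF that(1)] key[OF that(2)] that(3) nz br_zero_trans[of "ls ! key l" l l']
    by (metis br_commute_zero nth_mem)
  define ls' where "ls' = sort_key key ls"
  have mset: "mset ls' = mset ls" by (simp add: ls'_def)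
  then have set: "set ls' = set ls" and len': "length ls' = m + m"
    using len by (auto dest: mset_eq_setD mset_eq_length)
  have sorted: "key (ls' ! i) \<le> key (ls' ! j)" if "i \<le> j" "j < m + m" for i j
    using sorted_nth_mono[of "map key ls'" i j] that len' by (simp add: ls'_def)
  have "br (ls' ! k) (ls' ! (m + k)) \<noteq> 0" if "k < m" for k
  proof
    assume zero: "br (ls' ! k) (ls' ! (m + k)) = 0"
    have mem: "ls' ! i \<in> set ls" if "i < m + m" for i using that len' set nth_mem by metis
    have "key (ls' ! k) = key (ls' ! (m + k))" using zero \<open>k < m\<close> by (intro key_eq mem) auto
    then have "br (ls' ! i) (ls' ! k) = 0" if "k \<le> i" "i \<le> m + k" for i
      using that \<open>k < m\<close> sorted[of k i] sorted[of i "m + k"] by (intro eq_key mem) auto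
    \<comment> \<open>Sortedness forces all m + 1 entries from k to m + k into the same class, one
      more than \<open>count\<close> allows.\<close>
    then have "{k..m + k} \<subseteq> {i. i < length ls' \<and> br (ls' ! i) (ls' ! k) = 0}"
      using \<open>k < m\<close> len' by auto
    then have "m + 1 \<le> card {i. i < length ls' \<and> br (ls' ! i) (ls' ! k) = 0}"
      using card_mono[of "{i. i < length ls' \<and> br (ls' ! i) (ls' ! k) = 0}" "{k..m + k}"] by simp
    also have "\<dots> = root_count ls' (ls' ! k)" by (simp add: root_count_def length_filter_conv_card)
    also have "\<dots> = root_count ls (ls' ! k)"
      using mset by (metis root_count_def mset_filter size_mset)
    also have "\<dots> \<le> m" using mem[of k] \<open>k < m\<close> nz by (intro count) auto
    finally show False by simp
  qed
  with mset show ?thesis by blast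
qed

section \<open>Bracket invariants and the converse half of the criterion\<close>

context
  assumes alg_closed: "\<forall>p :: 'k::field_char_0 poly. 0 < degree p \<longrightarrow> (\<exists>x. poly p x = 0)"
begin

lemma product_form_split:
  fixes w :: "'i \<times> 'k \<times> 'k \<Rightarrow> 'k"
  assumes w: "w \<in> form_families I \<delta>" and ij: "i \<in> I" "j \<in> I" "0 < \<delta> i" "0 < \<delta> j"
  shows "\<exists>ls. length ls = a * \<delta> i + b * \<delta> j \<and> (\<lambda>x y. w (i, x, y) ^ a * w (j, x, y) ^ b) = br_prod ls"
proof -
  have split: "\<exists>ls. length ls = \<delta> k \<and> (\<lambda>x y. w (k, x, y)) = br_prod ls" if "k \<in> I" "0 < \<delta> k" for k
    using w that by (intro binary_forms_split[OF alg_closed]) (auto simp: form_families_def)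
  obtain li lj where l: "length li = \<delta> i" "(\<lambda>x y. w (i, x, y)) = br_prod li"
    "length lj = \<delta> j" "(\<lambda>x y. w (j, x, y)) = br_prod lj"
    using split ij by meson
  have "w (i, x, y) = br_prod li x y" "w (j, x, y) = br_prod lj x y" for x y
    using l(2,4) by (metis)+
  then show ?thesis
    using l(1,3)
    by (intro exI[of _ "concat (replicate a li) @ concat (replicate b lj)"])
       (auto simp: br_prod_append br_prod_concat_replicate length_concat sum_list_replicate fun_eq_iff)
qed

lemma eval_alg_pullback_poly_fun:
  assumes "G \<in> eval_alg"
  shows "(\<lambda>v :: 'i \<times> 'k \<times> 'k \<Rightarrow> 'k. G (\<lambda>x y. v (i, x, y) ^ a * v (j, x, y) ^ b)) \<in> poly_funs S"
  using assms unfolding eval_alg_def poly_funs_def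
proof induction
  case (gen f)
  then obtain x y where f: "f = (\<lambda>h. h x y)" by auto
  have "(\<lambda>v. v z) \<in> gen_alg {L. linear_on S L}" for z
    by (intro gen_alg.gen) (auto simp: linear_on_def)
  then show ?case unfolding f by (intro gen_alg.mult gen_alg_power)
qed (auto intro: gen_alg.const gen_alg.add gen_alg.mult)

text \<open>The action moves the factors of the product by a matrix of determinant 1. This preserves
  all brackets, and the matching sum depends on nothing else.\<close>

lemma bracket_invariant:
  fixes I :: "'i set"
  assumes ij: "i \<in> I" "j \<in> I" "0 < \<delta> i" "0 < \<delta> j" and m: "a * \<delta> i + b * \<delta> j = m + m"
    and G: "G \<in> eval_alg" "\<And>l :: nat \<Rightarrow> 'k \<times> 'k. matching_sum N m l = G (\<lambda>x y. \<Prod>i<m + m. br (l i) (x, y))"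
  shows "(\<lambda>v. G (\<lambda>x y. v (i, x, y) ^ a * v (j, x, y) ^ b)) \<in> invariants (form_families I \<delta>)"
  unfolding invariants_def
proof (intro CollectI conjI ballI eval_alg_pullback_poly_fun G(1))
  fix g :: "'k \<times> 'k \<times> 'k \<times> 'k" and w :: "'i \<times> 'k \<times> 'k \<Rightarrow> 'k"
  assume g: "g \<in> SL2" and w: "w \<in> form_families I \<delta>"
  obtain p q r s where gd: "g = (p, q, r, s)" by (cases g)
  have det: "p * s - q * r = 1" using g by (simp add: SL2_def gd)
  obtain ls where ls: "length ls = m + m" "(\<lambda>x y. w (i, x, y) ^ a * w (j, x, y) ^ b) = br_prod ls"
    using product_form_split[OF w ij, of a b] m by auto
  \<comment> \<open>Forms are composed with the inverse of g, so their roots are moved by g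
    itself.\<close>
  define T where "T l = (p * fst l + q * snd l, r * fst l + s * snd l)" for l
  have T: "br l (s * x - q * y, - r * x + p * y) = br (T l) (x, y)" for l x y
    by (simp add: br_def T_def algebra_simps)
  have brT: "br (T l) (T l') = br l l'" for l l'
  proof -
    have "br (T l) (T l') = (p * s - q * r) * br l l'" by (simp add: br_def T_def algebra_simps)
    with det show ?thesis by simp
  qed
  have wp: "w (i, x, y) ^ a * w (j, x, y) ^ b = (\<Prod>k<m + m. br (ls ! k) (x, y))" for x y
    using fun_cong[OF fun_cong[OF ls(2)], of x y] by (simp add: br_prod_nth ls(1))
  have "G (\<lambda>x y. sl2_act g w (i, x, y) ^ a * sl2_act g w (j, x, y) ^ b) =
      G (\<lambda>x y. \<Prod>k<m + m. br (T (ls ! k)) (x, y))"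
    by (simp only: sl2_act_def gd split wp T)
  also have "\<dots> = matching_sum N m (\<lambda>k. T (ls ! k))" by (simp only: G(2))
  also have "\<dots> = matching_sum N m (\<lambda>k. ls ! k)" by (simp only: matching_sum_def brT)
  also have "\<dots> = G (\<lambda>x y. w (i, x, y) ^ a * w (j, x, y) ^ b)" by (simp only: G(2) wp)
  finally show "G (\<lambda>x y. sl2_act g w (i, x, y) ^ a * sl2_act g w (j, x, y) ^ b) =
     G (\<lambda>x y. w (i, x, y) ^ a * w (j, x, y) ^ b)" .
qed

text \<open>Otherwise the factors could be ordered so that the identity permutation contributes a
  nonzero bracket product. But each matching sum with N > 0 has the value it takes at the zero
  family, namely 0, so every single summand would vanish.\<close>

lemma no_balanced_product_if_invariants_vanish:
  assumes w: "w \<in> form_families I \<delta>"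
    and null: "\<And>F. F \<in> invariants (form_families I \<delta>) \<Longrightarrow> F w = F (\<lambda>_. 0 :: 'k)"
    and ij: "i \<in> I" "j \<in> I" "0 < \<delta> i" "0 < \<delta> j" and m: "a * \<delta> i + b * \<delta> j = m + m" "0 < m"
    and ls: "length ls = m + m" "(0, 0) \<notin> set ls" "(\<lambda>x y. w (i, x, y) ^ a * w (j, x, y) ^ b) = br_prod ls"
  shows "\<exists>u. u \<noteq> (0, 0) \<and> m < root_count ls u"
proof (rule ccontr)
  assume "\<not> ?thesis"
  then have "\<And>u. u \<noteq> (0, 0) \<Longrightarrow> root_count ls u \<le> m" by (meson not_less)
  from ex_matching[OF ls(1,2) this] obtain ls' where ls': "mset ls' = mset ls"
    "\<And>k. k < m \<Longrightarrow> br (ls' ! k) (ls' ! (m + k)) \<noteq> 0" by blast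
  have len: "length ls' = m + m" using ls'(1) ls(1) by (metis size_mset)
  have "br_prod ls x y = br_prod ls' x y" for x y
    unfolding br_prod_def using ls'(1) by (metis mset_map prod_mset_prod_list)
  then have wp: "w (i, x, y) ^ a * w (j, x, y) ^ b = (\<Prod>k<m + m. br (ls' ! k) (x, y))" for x y
    using fun_cong[OF fun_cong[OF ls(3)], of x y] by (simp add: br_prod_nth len)
  have "(\<Sum>\<sigma> | \<sigma> permutes {..<m + m}. (\<Prod>k<m. br (ls' ! \<sigma> k) (ls' ! \<sigma> (m + k))) ^ N) = 0" if N: "0 < N" for N
  proof -
    obtain G where G: "G \<in> eval_alg"
      "\<And>l :: nat \<Rightarrow> 'k \<times> 'k. matching_sum N m l = G (\<lambda>x y. \<Prod>i<m + m. br (l i) (x, y))"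
      using matching_sum_in_eval_alg[OF alg_closed N, of m] by blast
    have "matching_sum N m (\<lambda>k. ls' ! k) = G (\<lambda>x y. w (i, x, y) ^ a * w (j, x, y) ^ b)"
      by (simp only: G(2) wp)
    also have "\<dots> = G (\<lambda>x y. 0 ^ a * 0 ^ b)"
      using null[OF bracket_invariant[where \<delta> = \<delta>, OF ij m(1) G]] by simp
    \<comment> \<open>As m > 0, the exponents are not both 0 and the product is the zero form.
      Written with all factors (0, 0), it has matching sum 0.\<close>
    also have "(\<lambda>x y :: 'k. 0 ^ a * 0 ^ b :: 'k) = (\<lambda>x y. \<Prod>k<m + m. br (0, 0) (x, y))"
      using m by (cases "a = 0"; cases "b = 0") (auto simp: br_zero_left fun_eq_iff power_0_left)
    also have "G \<dots> = matching_sum N m (\<lambda>_. (0, 0))" by (simp only: G(2))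
    also have "\<dots> = 0" using m(2) N by (simp add: matching_sum_def br_zero_left power_0_left)
    finally show ?thesis by (simp add: matching_sum_def)
  qed
  from power_sums_zero_imp_zero[OF _ this, of id]
  have "(\<Prod>k<m. br (ls' ! k) (ls' ! (m + k))) = 0" by (simp add: finite_permutations permutes_id)
  with ls'(2) show False by auto
qed

text \<open>Each nonzero member has a root above half its degree, by applying the previous lemma to
  its square. If the root of member i failed for member j, exponents weighted by the two surpluses
  would give a product without any root above half its degree.\<close>

lemma common_high_root_if_invariants_vanish:
  assumes w: "w \<in> form_families I \<delta>"
    and null: "\<And>F. F \<in> invariants (form_families I \<delta>) \<Longrightarrow> F w = F (\<lambda>_. 0 :: 'k)"
  shows "\<exists>u. u \<noteq> (0, 0) \<and> (\<forall>i\<in>I. high_root u (\<delta> i) (\<lambda>x y. w (i, x, y)))"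
proof -
  have deg0: "(\<lambda>x y. w (i, x, y)) = (\<lambda>x y. 0)" if i: "i \<in> I" "\<delta> i = 0" for i
  proof -
    have const: "v (i, x, y) = v (i, 0, 0)" if "v \<in> form_families I \<delta>" for v :: "'a \<times> 'k \<times> 'k \<Rightarrow> 'k" and x y
      using that i by (auto simp: form_families_def binary_forms_def dest!: bspec[of I _ i])
    \<comment> \<open>The origin is fixed by the group, and the value there is the constant form
      itself.\<close>
    have "(\<lambda>v. v (i, 0, 0)) \<in> invariants (form_families I \<delta>)"
      unfolding invariants_def poly_funs_def
      by (auto intro!: gen_alg.gen simp: linear_on_def sl2_act_def SL2_def)
    from null[OF this] have "w (i, 0, 0) = 0" by simp
    with const[OF w] show ?thesis by (auto simp: fun_eq_iff)
  qed
  \<comment> \<open>Zero members admit every u; the nonzero ones factor without an entry (0,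
    0).\<close>
  define J where "J = {i\<in>I. (\<lambda>x y. w (i, x, y)) \<noteq> (\<lambda>x y. 0)}"
  have zero: "high_root u (\<delta> i) (\<lambda>x y. w (i, x, y))" if "i \<in> I" "i \<notin> J" for i u
    using that by (auto simp: high_root_def J_def fun_eq_iff intro!: bexI[OF _ binary_forms_zero])
  have pos: "0 < \<delta> i" if "i \<in> J" for i using that deg0[of i] by (auto simp: J_def)
  have "\<forall>i\<in>J. \<exists>ls. length ls = \<delta> i \<and> (\<lambda>x y. w (i, x, y)) = br_prod ls"
    using w pos by (intro ballI binary_forms_split[OF alg_closed]) (auto simp: form_families_def J_def)
  from bchoice[OF this] obtain L where L: "\<And>i. i \<in> J \<Longrightarrow> length (L i) = \<delta> i"
    "\<And>i. i \<in> J \<Longrightarrow> (\<lambda>x y. w (i, x, y)) = br_prod (L i)" by blast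
  have wL: "w (i, x, y) = br_prod (L i) x y" if "i \<in> J" for i x y
    using fun_cong[OF fun_cong[OF L(2)[OF that]], of x y] .
  have nz: "(0, 0) \<notin> set (L i)" if "i \<in> J" for i
  proof
    assume "(0, 0) \<in> set (L i)"
    then have "br (0, 0) (x, y) \<in> set (map (\<lambda>l. br l (x, y)) (L i))" for x y
      unfolding set_map by (rule imageI)
    then have "br_prod (L i) x y = 0" for x y
      unfolding br_prod_def prod_list_zero_iff by (simp only: br_zero_left)
    then have "w (i, x, y) = 0" for x y using wL[OF that] by simp
    with that show False by (simp add: J_def)
  qed
  have unbalanced: "\<exists>u. u \<noteq> (0, 0) \<and> m < a * root_count (L i) u + b * root_count (L j) u"
    if "i \<in> J" "j \<in> J" "a * \<delta> i + b * \<delta> j = m + m" "0 < m" for i j a b m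
  proof -
    have ls: "length (concat (replicate a (L i)) @ concat (replicate b (L j))) = m + m"
      using that L(1) by (simp add: length_concat sum_list_replicate)
    have nz': "(0, 0) \<notin> set (concat (replicate a (L i)) @ concat (replicate b (L j)))"
      using nz that by (auto simp: set_replicate_conv_if split: if_splits)
    have "(\<lambda>x y. w (i, x, y) ^ a * w (j, x, y) ^ b) =
        br_prod (concat (replicate a (L i)) @ concat (replicate b (L j)))"
      using that by (auto simp: fun_eq_iff wL br_prod_append br_prod_concat_replicate)
    from no_balanced_product_if_invariants_vanish[OF w null _ _ pos pos that(3,4) ls nz' this] that
    show ?thesis by (auto simp: J_def root_count_append root_count_concat_replicate)
  qed
  \<comment> \<open>Applied to i = j with exponents 1 and 1, since \<delta> i itself may be
    odd.\<close>
  have "\<exists>u. u \<noteq> (0, 0) \<and> \<delta> i < 2 * root_count (L i) u" if "i \<in> J" for i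
    using unbalanced[OF that that, of 1 1 "\<delta> i"] pos[OF that] by (auto simp: mult_2)
  then have "\<forall>i\<in>J. \<exists>u. u \<noteq> (0, 0) \<and> \<delta> i < 2 * root_count (L i) u" by blast
  from bchoice[OF this] obtain U where U: "\<And>i. i \<in> J \<Longrightarrow> U i \<noteq> (0, 0)"
    "\<And>i. i \<in> J \<Longrightarrow> \<delta> i < 2 * root_count (L i) (U i)" by blast
  show ?thesis
  proof (cases "J = {}")
    case True
    then show ?thesis using zero by (intro exI[of _ "(1, 0)"]) auto
  next
    case False
    then obtain i where i: "i \<in> J" by blast
    have "\<delta> j < 2 * root_count (L j) (U i)" if j: "j \<in> J" for j
    proof (rule ccontr)
      assume low: "\<not> \<delta> j < 2 * root_count (L j) (U i)"
      \<comment> \<open>A and B are twice the surplus over half the degree. At any root not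
        proportional to its own, a member falls short by at least the same amount.\<close>
      define A where "A = 2 * root_count (L i) (U i) - \<delta> i"
      define B where "B = 2 * root_count (L j) (U j) - \<delta> j"
      have A: "2 * root_count (L i) (U i) = \<delta> i + A" "0 < A" using U(2)[OF i] by (auto simp: A_def)
      have B: "2 * root_count (L j) (U j) = \<delta> j + B" "0 < B" using U(2)[OF j] by (auto simp: B_def)
      have i_off: "2 * root_count (L i) u + A \<le> \<delta> i" if "br (U i) u \<noteq> 0" for u
        using root_count_add_le[OF that nz[OF i]] A L(1)[OF i] by simp
      have j_off: "2 * root_count (L j) u + B \<le> \<delta> j" if "br (U j) u \<noteq> 0" for u
        using root_count_add_le[OF that nz[OF j]] B L(1)[OF j] by simp
      have sep: "br (U j) (U i) \<noteq> 0"
        using low U(2)[OF j] root_count_cong[OF U(1)[OF j] U(1)[OF i], of "L j"] by auto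
      have "0 < B * \<delta> i + A * \<delta> j" using A B pos[OF i] by simp
      then obtain u where u: "u \<noteq> (0, 0)"
        "B * \<delta> i + A * \<delta> j < 2 * B * root_count (L i) u + 2 * A * root_count (L j) u"
        using unbalanced[OF i j, of "2 * B" "2 * A" "B * \<delta> i + A * \<delta> j"] by auto
      \<comment> \<open>At the root of i the surplus A B of the first factor meets a deficit of at
        least A B of the second; the root of j is symmetric, and elsewhere both fall short.\<close>
      have "B * (2 * root_count (L i) u) + A * (2 * root_count (L j) u) \<le> B * \<delta> i + A * \<delta> j"
      proof (cases "br (U i) u = 0")
        case True
        then have eq: "2 * root_count (L i) u = \<delta> i + A"
          using root_count_cong[OF U(1)[OF i] u(1), of "L i"] A(1) by simp
        have "br (U j) u \<noteq> 0"
          using True sep br_zero_trans[OF u(1), of "U j" "U i"] by auto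
        from mult_le_mono2[OF j_off[OF this], of A] show ?thesis
          unfolding eq by (simp add: algebra_simps)
      next
        case False
        note off = mult_le_mono2[OF i_off[OF this], of B]
        show ?thesis
        proof (cases "br (U j) u = 0")
          case True
          then have eq: "2 * root_count (L j) u = \<delta> j + B"
            using root_count_cong[OF U(1)[OF j] u(1), of "L j"] B(1) by simp
          from off show ?thesis unfolding eq by (simp add: algebra_simps)
        next
          case False
          from mult_le_mono2[OF j_off[OF this], of A] off show ?thesis by (simp add: algebra_simps)
        qed
      qed
      with u(2) show False by (simp add: mult_ac)
    qed
    then have "high_root (U i) (\<delta> j) (\<lambda>x y. w (j, x, y))" if "j \<in> J" for j
      using high_root_br_prod[OF U(1)[OF i] pos[OF that] L(1)[OF that]] L(2)[OF that] that by simp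
    then show ?thesis using zero U(1)[OF i] by blast
  qed
qed

end

section \<open>Polarizations\<close>

text \<open>Viewed as a polynomial in the last variable, the sum has vanishing coefficients. The
  coefficient of exponent I n retains just the indices agreeing with I there, which the remaining
  variables still tell apart, so induction applies.\<close>

lemma multivariate_poly_coeffs_zero:
  fixes c :: "(nat \<Rightarrow> nat) \<Rightarrow> 'k::field_char_0"
  assumes "finite A" "\<And>I J. I \<in> A \<Longrightarrow> J \<in> A \<Longrightarrow> (\<And>t. t < n \<Longrightarrow> I t = J t) \<Longrightarrow> I = J"
    and "\<And>\<alpha>. (\<Sum>I\<in>A. c I * (\<Prod>t<n. \<alpha> t ^ I t)) = 0" and "I \<in> A"
  shows "c I = 0"
  using assms
proof (induction n arbitrary: A)
  case 0
  have "A = {I}" using 0 by auto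
  with 0(3) show ?case by simp
next
  case (Suc n)
  let ?A = "{J\<in>A. J n = I n}"
  have "(\<Sum>J\<in>?A. c J * (\<Prod>t<n. \<alpha> t ^ J t)) = 0" for \<alpha>
  proof -
    define p where "p = (\<Sum>J\<in>A. monom (c J * (\<Prod>t<n. \<alpha> t ^ J t)) (J n))"
    have "poly p s = 0" for s
    proof -
      have "(\<Sum>J\<in>A. c J * (\<Prod>t<Suc n. (\<alpha>(n := s)) t ^ J t)) = 0" by (rule Suc.prems(3))
      moreover have "(\<Prod>t<n. (\<alpha>(n := s)) t ^ J t) = (\<Prod>t<n. \<alpha> t ^ J t)" for J :: "nat \<Rightarrow> nat"
        by (intro prod.cong) auto
      ultimately show ?thesis
        by (simp add: p_def poly_sum poly_monom mult.assoc)
    qed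
    then have "p = 0" using poly_all_0_iff_0 by blast
    moreover have "coeff p (I n) = (\<Sum>J\<in>A. if J n = I n then c J * (\<Prod>t<n. \<alpha> t ^ J t) else 0)"
      by (simp add: p_def coeff_sum)
    ultimately show ?thesis using Suc.prems(1) by (simp add: sum.inter_filter)
  qed
  moreover have "J = K" if "J \<in> ?A" "K \<in> ?A" "\<And>t. t < n \<Longrightarrow> J t = K t" for J K
  proof (rule Suc.prems(2))
    show "J t = K t" if "t < Suc n" for t
      using that \<open>J \<in> ?A\<close> \<open>K \<in> ?A\<close> \<open>\<And>t. t < n \<Longrightarrow> J t = K t\<close> by (auto simp: less_Suc_eq)
  qed (use that in auto)
  ultimately show ?case using Suc.prems(1,4) by (intro Suc.IH[of ?A]) auto
qed

text \<open>The property under the \<open>THE\<close> in \<open>pol_coeffs\<close>, with the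
  function of \<alpha> abstracted.\<close>

definition polarization_coeffs :: "nat \<Rightarrow> ((nat \<Rightarrow> 'k::comm_ring_1) \<Rightarrow> 'k) \<Rightarrow> ((nat \<Rightarrow> nat) \<Rightarrow> 'k) \<Rightarrow> bool" where
  "polarization_coeffs n \<phi> c \<longleftrightarrow> finite {I. c I \<noteq> 0} \<and> (\<forall>I. c I \<noteq> 0 \<longrightarrow> (\<forall>t. n \<le> t \<longrightarrow> I t = 0)) \<and>
     (\<forall>\<alpha>. \<phi> \<alpha> = (\<Sum>I\<in>{I. c I \<noteq> 0}. c I * (\<Prod>t<n. \<alpha> t ^ I t)))"

lemma polarization_coeffs_unique:
  fixes c :: "(nat \<Rightarrow> nat) \<Rightarrow> 'k::field_char_0"
  assumes "polarization_coeffs n \<phi> c" "polarization_coeffs n \<phi> c'"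
  shows "c = c'"
proof
  fix I
  let ?A = "{I. c I \<noteq> 0} \<union> {I. c' I \<noteq> 0}"
  have fin: "finite ?A" using assms by (auto simp: polarization_coeffs_def)
  have supp: "J t = 0" if "J \<in> ?A" "n \<le> t" for J t
    using assms that by (auto simp: polarization_coeffs_def)
  have "c I - c' I = 0" if "I \<in> ?A"
  proof (rule multivariate_poly_coeffs_zero[OF fin _ _ that, of n])
    fix \<alpha> :: "nat \<Rightarrow> 'k"
    have "\<phi> \<alpha> = (\<Sum>I\<in>?A. c I * (\<Prod>t<n. \<alpha> t ^ I t))"
      using assms(1) fin unfolding polarization_coeffs_def
      by (auto intro!: sum.mono_neutral_left)
    moreover have "\<phi> \<alpha> = (\<Sum>I\<in>?A. c' I * (\<Prod>t<n. \<alpha> t ^ I t))"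
      using assms(2) fin unfolding polarization_coeffs_def
      by (auto intro!: sum.mono_neutral_left)
    ultimately show "(\<Sum>I\<in>?A. (c I - c' I) * (\<Prod>t<n. \<alpha> t ^ I t)) = 0"
      by (simp add: left_diff_distrib sum_subtractf)
  next
    fix I J assume IJ: "I \<in> ?A" "J \<in> ?A" "\<And>t. t < n \<Longrightarrow> I t = J t"
    show "I = J"
    proof
      fix t
      show "I t = J t"
        using IJ(3)[of t] supp[OF IJ(1), of t] supp[OF IJ(2), of t] by (cases "t < n") auto
    qed
  qed
  then show "c I = c' I" by (cases "c I = 0 \<and> c' I = 0") auto
qed

lemma polarization_coeffs_of_list:
  fixes xs :: "('k::comm_ring_1 \<times> (nat \<Rightarrow> nat)) list"
  assumes supp: "\<And>a I t. (a, I) \<in> set xs \<Longrightarrow> n \<le> t \<Longrightarrow> I t = 0"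
    and \<phi>: "\<And>\<alpha>. \<phi> \<alpha> = (\<Sum>(a, I)\<leftarrow>xs. a * (\<Prod>t<n. \<alpha> t ^ I t))"
  shows "polarization_coeffs n \<phi> (\<lambda>I. \<Sum>(a, J)\<leftarrow>xs. if J = I then a else 0)"
proof -
  let ?c = "\<lambda>ys I. \<Sum>(a, J)\<leftarrow>ys. if J = I then a else 0 :: 'k"
  have zero: "?c ys I = 0" if "I \<notin> snd ` set ys" for ys :: "('k \<times> (nat \<Rightarrow> nat)) list" and I
    using that by (induction ys) auto
  then have sub: "{I. ?c xs I \<noteq> 0} \<subseteq> snd ` set xs" by blast
  have "(\<Sum>(a, I)\<leftarrow>ys. a * M I) = (\<Sum>I\<in>A. ?c ys I * M I)"
    if "finite A" "snd ` set ys \<subseteq> A" for ys A and M :: "(nat \<Rightarrow> nat) \<Rightarrow> 'k"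
    using that(2)
  proof (induction ys)
    case (Cons y ys)
    obtain a J where y: "y = (a, J)" by (cases y)
    have "(\<Sum>I\<in>A. ?c (y # ys) I * M I) = (\<Sum>I\<in>A. (if J = I then a * M I else 0) + ?c ys I * M I)"
      by (intro sum.cong) (auto simp: y algebra_simps)
    also have "\<dots> = a * M J + (\<Sum>I\<in>A. ?c ys I * M I)"
      using Cons.prems that(1) by (simp add: sum.distrib y)
    finally show ?case using Cons by (simp add: y)
  qed simp
  from this[of "snd ` set xs" xs]
  have "\<phi> \<alpha> = (\<Sum>I\<in>{I. ?c xs I \<noteq> 0}. ?c xs I * (\<Prod>t<n. \<alpha> t ^ I t))" for \<alpha>
    unfolding \<phi> using sub by (auto intro!: sum.mono_neutral_right)
  moreover have "finite {I. ?c xs I \<noteq> 0}" using sub finite_subset by blast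
  moreover have "I t = 0" if "?c xs I \<noteq> 0" "n \<le> t" for I t
  proof -
    have "I \<in> snd ` set xs" using that(1) sub by blast
    then obtain a where "(a, I) \<in> set xs" by auto
    then show ?thesis using that(2) by (rule supp)
  qed
  ultimately show ?thesis unfolding polarization_coeffs_def by blast
qed

lemma lin_comb_in_Vspace:
  assumes "w \<in> Vsum n ds"
  shows "lin_comb n \<alpha> w \<in> Vspace ds"
  using assms
  by (auto simp: Vsum_eq_form_families Vspace_eq_form_families form_families_def lin_comb_def
      intro!: binary_forms_sum binary_forms_scale)

text \<open>Induction on the polynomial function: linear functionals give unit exponents, sums
  append lists, and products multiply entries pairwise. Repeated exponents are harmless, as
  \<open>polarization_coeffs_of_list\<close> collects them.\<close>

lemma poly_funs_lin_comb_monomials: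
  fixes f :: "(nat \<times> 'k \<times> 'k \<Rightarrow> 'k::comm_ring_1) \<Rightarrow> 'k"
  assumes f: "f \<in> poly_funs (Vspace ds)" and w: "w \<in> Vsum n ds"
  shows "\<exists>xs. (\<forall>(a, I)\<in>set xs. \<forall>t\<ge>n. I t = 0) \<and>
    (\<forall>\<alpha>. f (lin_comb n \<alpha> w) = (\<Sum>(a, I)\<leftarrow>xs. a * (\<Prod>t<n. \<alpha> t ^ I t)))"
  using f unfolding poly_funs_def
proof induction
  case (const c)
  show ?case by (intro exI[of _ "[(c, \<lambda>_. 0)]"]) simp
next
  case (gen L)
  define v where "v t = (\<lambda>(i, x, y). w ((t, i), x, y))" for t
  have v: "v t \<in> form_families {..<length ds} ((!) ds)" if "t < n" for t
    using w that by (auto simp: v_def Vsum_eq_form_families form_families_def)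
  have "lin_comb n \<alpha> w = (\<lambda>z. \<Sum>t<n. \<alpha> t * v t z)" for \<alpha>
    by (auto simp: lin_comb_def v_def)
  then have "L (lin_comb n \<alpha> w) = (\<Sum>t<n. \<alpha> t * L (v t))" for \<alpha>
    using gen v by (simp only: mem_Collect_eq Vspace_eq_form_families) (intro linear_on_form_families_sum, auto)
  moreover have "(\<Sum>(a, I)\<leftarrow>map (\<lambda>s. (L (v s), \<lambda>t. if t = s then 1 else 0)) [0..<n]. a * (\<Prod>t<n. \<alpha> t ^ I t))
     = (\<Sum>t<n. \<alpha> t * L (v t))" for \<alpha> :: "nat \<Rightarrow> 'k"
  proof -
    have "(\<Prod>t<n. \<alpha> t ^ (if t = s then 1 else 0)) = \<alpha> s" if "s < n" for s
    proof -
      have "(\<Prod>t<n. \<alpha> t ^ (if t = s then 1 else 0)) = (\<Prod>t<n. if t = s then \<alpha> t else 1)"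
        by (intro prod.cong) auto
      then show ?thesis using that by simp
    qed
    then show ?thesis
      by (simp add: sum_list_sum_nth atLeast0LessThan comp_def mult.commute)
  qed
  ultimately show ?case
    by (intro exI[of _ "map (\<lambda>s. (L (v s), \<lambda>t. if t = s then 1 else 0)) [0..<n]"]) auto
next
  case (add f g)
  then obtain xs ys where "\<forall>(a, I)\<in>set xs. \<forall>t\<ge>n. I t = 0" "\<forall>(a, I)\<in>set ys. \<forall>t\<ge>n. I t = 0"
    "\<forall>\<alpha>. f (lin_comb n \<alpha> w) = (\<Sum>(a, I)\<leftarrow>xs. a * (\<Prod>t<n. \<alpha> t ^ I t))"
    "\<forall>\<alpha>. g (lin_comb n \<alpha> w) = (\<Sum>(a, I)\<leftarrow>ys. a * (\<Prod>t<n. \<alpha> t ^ I t))" by (elim exE conjE) simp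
  then show ?case by (intro exI[of _ "xs @ ys"]) auto
next
  case (mult f g)
  then obtain xs ys where xy: "\<forall>(a, I)\<in>set xs. \<forall>t\<ge>n. I t = 0" "\<forall>(a, I)\<in>set ys. \<forall>t\<ge>n. I t = 0"
    "\<forall>\<alpha>. f (lin_comb n \<alpha> w) = (\<Sum>(a, I)\<leftarrow>xs. a * (\<Prod>t<n. \<alpha> t ^ I t))"
    "\<forall>\<alpha>. g (lin_comb n \<alpha> w) = (\<Sum>(a, I)\<leftarrow>ys. a * (\<Prod>t<n. \<alpha> t ^ I t))" by (elim exE conjE) simp
  define zs where "zs = concat (map (\<lambda>(a, I). map (\<lambda>(b, J). (a * b, \<lambda>t. I t + J t)) ys) xs)"
  have 1: "(\<Sum>(a, I)\<leftarrow>map (\<lambda>(b, J). (a * b, \<lambda>t. I t + J t)) ys'. a * (\<Prod>t<n. \<alpha> t ^ I t))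
     = a * (\<Prod>t<n. \<alpha> t ^ I t) * (\<Sum>(b, J)\<leftarrow>ys'. b * (\<Prod>t<n. \<alpha> t ^ J t))" for a I ys' and \<alpha> :: "nat \<Rightarrow> 'k"
    by (induction ys') (auto simp: power_add prod.distrib algebra_simps)
  have "(\<Sum>(a, I)\<leftarrow>concat (map (\<lambda>(a, I). map (\<lambda>(b, J). (a * b, \<lambda>t. I t + J t)) ys) xs'). a * (\<Prod>t<n. \<alpha> t ^ I t)) =
     (\<Sum>(a, I)\<leftarrow>xs'. a * (\<Prod>t<n. \<alpha> t ^ I t)) * (\<Sum>(b, J)\<leftarrow>ys. b * (\<Prod>t<n. \<alpha> t ^ J t))" for xs' and \<alpha> :: "nat \<Rightarrow> 'k"
    by (induction xs') (auto simp del: map_map simp: 1 distrib_right)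
  with xy(3,4) have "\<forall>\<alpha>. f (lin_comb n \<alpha> w) * g (lin_comb n \<alpha> w) = (\<Sum>(a, I)\<leftarrow>zs. a * (\<Prod>t<n. \<alpha> t ^ I t))"
    unfolding zs_def by simp
  moreover have "\<forall>(a, I)\<in>set zs. \<forall>t\<ge>n. I t = 0"
    using xy(1,2) by (auto simp: zs_def dest!: bspec)
  ultimately show ?case by blast
qed

lemma polarization_coeffs_pol_coeffs:
  fixes f :: "(nat \<times> 'k \<times> 'k \<Rightarrow> 'k::field_char_0) \<Rightarrow> 'k"
  assumes "f \<in> poly_funs (Vspace ds)" "w \<in> Vsum n ds"
  shows "polarization_coeffs n (\<lambda>\<alpha>. f (lin_comb n \<alpha> w)) (pol_coeffs n f w)"
proof -
  obtain xs where xs: "\<forall>(a, I)\<in>set xs. \<forall>t\<ge>n. I t = 0"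
    "\<forall>\<alpha>. f (lin_comb n \<alpha> w) = (\<Sum>(a, I)\<leftarrow>xs. a * (\<Prod>t<n. \<alpha> t ^ I t))"
    using poly_funs_lin_comb_monomials[OF assms] by (elim exE conjE) simp
  have ex: "polarization_coeffs n (\<lambda>\<alpha>. f (lin_comb n \<alpha> w)) (\<lambda>I. \<Sum>(a, J)\<leftarrow>xs. if J = I then a else 0)"
    using xs by (intro polarization_coeffs_of_list) auto
  have "pol_coeffs n f w = (THE c. polarization_coeffs n (\<lambda>\<alpha>. f (lin_comb n \<alpha> w)) c)"
    by (simp only: pol_coeffs_def polarization_coeffs_def)
  also have "\<dots> = (\<lambda>I. \<Sum>(a, J)\<leftarrow>xs. if J = I then a else 0)"
  proof (rule the_equality[where P = "polarization_coeffs n (\<lambda>\<alpha>. f (lin_comb n \<alpha> w))"])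
    show "polarization_coeffs n (\<lambda>\<alpha>. f (lin_comb n \<alpha> w)) (\<lambda>I. \<Sum>(a, J)\<leftarrow>xs. if J = I then a else 0)"
      by (fact ex)
    show "c = (\<lambda>I. \<Sum>(a, J)\<leftarrow>xs. if J = I then a else 0)"
      if "polarization_coeffs n (\<lambda>\<alpha>. f (lin_comb n \<alpha> w)) c" for c
      by (rule polarization_coeffs_unique[OF that ex])
  qed
  finally show ?thesis using ex by (simp only:)
qed

text \<open>The polarizations of f agree at w and at 0 exactly when the two polynomials in \<alpha>
  that they are the coefficients of agree, and the one at 0 is constantly f(0).\<close>

lemma pol_nullcone_iff_invariants:
  fixes w :: "(nat \<times> nat) \<times> 'k \<times> 'k \<Rightarrow> 'k::field_char_0"
  assumes w: "w \<in> Vsum n ds"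
  shows "w \<in> pol_nullcone n ds \<longleftrightarrow>
    (\<forall>\<alpha>. \<forall>f\<in>invariants (Vspace ds). f (lin_comb n \<alpha> w) = f (\<lambda>_. 0))"
proof
  have zero: "lin_comb n \<alpha> (\<lambda>_. 0) = (\<lambda>_. 0 :: 'k)" for \<alpha>
    by (auto simp: lin_comb_def)
  have 0: "(\<lambda>_. 0 :: 'k) \<in> Vsum n ds" unfolding Vsum_eq_form_families by (rule form_families_zero)
  {
    assume null: "w \<in> pol_nullcone n ds"
    show "\<forall>\<alpha>. \<forall>f\<in>invariants (Vspace ds). f (lin_comb n \<alpha> w) = f (\<lambda>_. 0)"
    proof (intro allI ballI)
      fix \<alpha> and f :: "(nat \<times> 'k \<times> 'k \<Rightarrow> 'k) \<Rightarrow> 'k" assume f: "f \<in> invariants (Vspace ds)"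
      have null': "\<forall>h\<in>pol_alg n ds. h w = h (\<lambda>_. 0)"
        using null by (simp add: pol_nullcone_def)
      have "(\<lambda>w. pol_coeffs n f w I) \<in> pol_alg n ds" for I
        unfolding pol_alg_def by (intro gen_alg.gen) (use f in auto)
      then have "pol_coeffs n f w I = pol_coeffs n f (\<lambda>_. 0) I" for I
        by (rule bspec[OF null'])
      then have eq: "pol_coeffs n f w = pol_coeffs n f (\<lambda>_. 0)" by (rule ext)
      have "f \<in> poly_funs (Vspace ds)" using f by (simp add: invariants_def)
      from polarization_coeffs_pol_coeffs[OF this w] polarization_coeffs_pol_coeffs[OF this 0]
      show "f (lin_comb n \<alpha> w) = f (\<lambda>_. 0)"
        unfolding polarization_coeffs_def eq zero by simp
    qed
  next
    assume *: "\<forall>\<alpha>. \<forall>f\<in>invariants (Vspace ds). f (lin_comb n \<alpha> w) = f (\<lambda>_. 0)"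
    have "h w = h (\<lambda>_. 0)" if "h \<in> pol_alg n ds" for h
      using that unfolding pol_alg_def
    proof induction
      case (gen h)
      then obtain f I where h: "h = (\<lambda>w. pol_coeffs n f w I)" and f: "f \<in> invariants (Vspace ds)" by blast
      have "f (lin_comb n \<alpha> w) = f (lin_comb n \<alpha> (\<lambda>_. 0))" for \<alpha>
        using *[rule_format, OF f, of \<alpha>] zero by simp
      \<comment> \<open>\<open>pol_coeffs\<close> sees w only through the function \<alpha> |-> f
        (\<open>lin_comb n\<close> \<alpha> w).\<close>
      then show ?case unfolding h pol_coeffs_def by (simp only:)
    qed simp_all
    with w show "w \<in> pol_nullcone n ds" by (simp add: pol_nullcone_def)
  }
qed

section \<open>Pencils of forms\<close>

lemma high_root_zero: "high_root u d (\<lambda>x y. 0)"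
  by (auto simp: high_root_def fun_eq_iff intro!: bexI[OF _ binary_forms_zero])

lemma high_root_add:
  assumes "high_root u d f" "high_root u d g"
  shows "high_root u d (\<lambda>x y. f x y + g x y)"
proof (cases "d = 0")
  case False
  then obtain f' g' where "f' \<in> binary_forms (d - (d div 2 + 1))" "g' \<in> binary_forms (d - (d div 2 + 1))"
    "f = (\<lambda>x y. br u (x, y) ^ (d div 2 + 1) * f' x y)" "g = (\<lambda>x y. br u (x, y) ^ (d div 2 + 1) * g' x y)"
    using assms by (auto simp: high_root_def)
  with False show ?thesis unfolding high_root_def
    by (auto intro!: bexI[OF _ binary_forms_add] simp: distrib_left)
qed (use assms in \<open>auto simp: high_root_def\<close>)

lemma high_root_scale:
  assumes "high_root u d f"
  shows "high_root u d (\<lambda>x y. a * f x y)"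
proof (cases "d = 0")
  case False
  then obtain f' where "f' \<in> binary_forms (d - (d div 2 + 1))"
    "f = (\<lambda>x y. br u (x, y) ^ (d div 2 + 1) * f' x y)"
    using assms by (auto simp: high_root_def)
  with False show ?thesis unfolding high_root_def
    by (auto intro!: bexI[OF _ binary_forms_scale[of _ _ a]] simp: mult_ac)
qed (use assms in \<open>auto simp: high_root_def\<close>)

lemma high_root_sum:
  assumes "\<And>i. i \<in> A \<Longrightarrow> high_root u d (f i)"
  shows "high_root u d (\<lambda>x y. \<Sum>i\<in>A. f i x y)"
  using assms by (induction A rule: infinite_finite_induct) (auto intro: high_root_zero high_root_add)

lemma high_root_cong:
  fixes u :: "'k::field \<times> 'k"
  assumes "u \<noteq> (0, 0)" "v \<noteq> (0, 0)" "br u v = 0" "high_root u d f"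
  shows "high_root v d f"
proof (cases "d = 0")
  case False
  obtain t where t: "\<And>z. br u z = t * br v z" using br_zero_scale[OF assms(2,3)] by blast
  obtain g where "g \<in> binary_forms (d - (d div 2 + 1))" "f = (\<lambda>x y. br u (x, y) ^ (d div 2 + 1) * g x y)"
    using assms False by (auto simp: high_root_def)
  with False show ?thesis unfolding high_root_def t
    by (auto intro!: bexI[OF _ binary_forms_scale[of _ _ "t ^ (d div 2 + 1)"]] simp: power_mult_distrib mult_ac)
qed (use assms in \<open>auto simp: high_root_def\<close>)

lemma high_root_imp_root: "high_root u d f \<Longrightarrow> f (fst u) (snd u) = 0"
  by (auto simp: high_root_def br_self split: if_splits)

text \<open>Two distinct roots above d/2 are too many. On the line u + z v, \<open>br u\<close> is a
  multiple of z and \<open>br v\<close> is constant, so z^p with p > d/2 would divide a polynomial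
  of degree at most d - p; hence f vanishes on the line, and homogeneity spreads this over the
  plane.\<close>

lemma high_root_unique:
  fixes u :: "'k::field_char_0 \<times> 'k"
  assumes f: "f \<in> binary_forms d" and hu: "high_root u d f" and hv: "high_root v d f"
    and nz: "br u v \<noteq> 0"
  shows "f x y = 0"
proof (cases "d = 0")
  case True
  then show ?thesis using hu by (simp add: high_root_def)
next
  case False
  define p where "p = d div 2 + 1"
  define D where "D = br u v"
  obtain g where g: "g \<in> binary_forms (d - p)" "\<And>x y. f x y = br u (x, y) ^ p * g x y"
    using hu False by (auto simp: high_root_def p_def fun_eq_iff)
  obtain g' where g': "g' \<in> binary_forms (d - p)" "\<And>x y. f x y = br v (x, y) ^ p * g' x y"
    using hv False unfolding high_root_def p_def[symmetric] fun_eq_iff by auto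
  obtain q where q: "\<And>z. g (fst u + fst v * z) (snd u + snd v * z) = poly q z"
    using binary_forms_poly[OF g(1)] by blast
  obtain q' where q': "degree q' \<le> d - p" "\<And>z. g' (fst u + fst v * z) (snd u + snd v * z) = poly q' z"
    using binary_forms_poly[OF g'(1)] by blast
  have brs: "br u (fst u + fst v * z, snd u + snd v * z) = D * z"
    "br v (fst u + fst v * z, snd u + snd v * z) = - D" for z
    by (simp_all add: br_def D_def algebra_simps)
  have "poly (monom (D ^ p) p * q) z = poly (smult ((- D) ^ p) q') z" for z
  proof -
    have "poly (monom (D ^ p) p * q) z = f (fst u + fst v * z) (snd u + snd v * z)"
      unfolding g(2) brs q by (simp add: poly_monom power_mult_distrib)
    also have "\<dots> = poly (smult ((- D) ^ p) q') z"
      unfolding g'(2) brs q' by simp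
    finally show ?thesis .
  qed
  then have eq: "monom (D ^ p) p * q = smult ((- D) ^ p) q'" using poly_eq_poly_eq_iff by blast
  have "q = 0"
  proof (rule ccontr)
    assume "q \<noteq> 0"
    then have "p \<le> degree (monom (D ^ p) p * q)"
      using nz by (simp add: degree_mult_eq D_def degree_monom_eq)
    also have "\<dots> \<le> d - p" unfolding eq using q'(1) by (meson degree_smult_le order_trans)
    finally show False using False by (auto simp: p_def)
  qed
  then have line: "f (fst u + fst v * z) (snd u + snd v * z) = 0" for z
    unfolding g(2) q by simp
  \<comment> \<open>Coordinates of (x, y) in the basis u, v by Cramer's rule.\<close>
  define s t where "s = br (x, y) v / D" and "t = br u (x, y) / D"
  have xy: "x = s * fst u + t * fst v" "y = s * snd u + t * snd v"
    using nz unfolding s_def t_def D_def by (simp_all add: field_simps) (simp_all add: br_def algebra_simps)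
  show ?thesis
  \<comment> \<open>Multiples of v are not scalar multiples of points on the line, but there
    \<open>br v\<close> vanishes.\<close>
  proof (cases "s = 0")
    case True
    then have "br v (x, y) = 0" unfolding xy by (simp add: br_def)
    then show ?thesis unfolding g'(2) by (simp add: p_def)
  next
    case False
    have "f (s * (fst u + fst v * (t / s))) (s * (snd u + snd v * (t / s))) = 0"
      unfolding binary_forms_homogeneous[OF f] line by simp
    moreover have "s * (fst u + fst v * (t / s)) = x" "s * (snd u + snd v * (t / s)) = y"
      using False unfolding xy by (simp_all add: field_simps)
    ultimately show ?thesis by simp
  qed
qed

text \<open>Subtracting a multiple of q gives r with a zero at a point where q has none, and the
  Wronskian of r and q is still zero. If r were nonzero, differentiation would lower its order there
  by exactly one, contradicting r q' = r' q.\<close>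

lemma wronskian_zero_imp_proportional:
  fixes p q :: "'k::field_char_0 poly"
  assumes W: "p * pderiv q = pderiv p * q" and "q \<noteq> 0"
  shows "\<exists>c. p = smult c q"
proof -
  have "infinite (UNIV :: 'k set)" by (rule infinite_UNIV_char_0)
  with poly_roots_finite[OF \<open>q \<noteq> 0\<close>] obtain s where s: "poly q s \<noteq> 0"
    by (metis (mono_tags, lifting) UNIV_I finite_subset mem_Collect_eq subsetI)
  define c where "c = poly p s / poly q s"
  define r where "r = p - smult c q"
  have rs: "poly r s = 0" using s by (simp add: r_def c_def)
  have Wr: "r * pderiv q = pderiv r * q"
    using W by (simp add: r_def pderiv_diff pderiv_smult algebra_simps)
  have "r = 0"
  proof (rule ccontr)
    assume "r \<noteq> 0"
    have "pderiv r \<noteq> 0"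
    proof
      assume "pderiv r = 0"
      then have "degree r = 0" by (simp add: pderiv_eq_0_iff)
      then obtain a where "r = [:a:]" by (metis degree_eq_zeroE)
      with rs \<open>r \<noteq> 0\<close> show False by simp
    qed
    then have nz: "pderiv r * q \<noteq> 0" using \<open>q \<noteq> 0\<close> by simp
    have "order s r = Suc (order s (pderiv r))"
      by (rule order_pderiv[OF \<open>r \<noteq> 0\<close> rs])
    moreover have "order s (pderiv r * q) = order s (pderiv r)"
      using nz s by (simp add: order_mult order_0I)
    moreover have "order s (r * pderiv q) = order s r + order s (pderiv q)"
      using nz Wr by (intro order_mult) simp
    ultimately show False using Wr by simp
  qed
  then show ?thesis unfolding r_def by auto
qed

text \<open>Homogeneity covers x \<noteq> 0. On a line of constant y the form is a polynomial in x,
  so it vanishes at x = 0 as well.\<close>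

lemma binary_form_eq_zero:
  fixes f :: "'k::field_char_0 \<Rightarrow> 'k \<Rightarrow> 'k"
  assumes f: "f \<in> binary_forms d" and zero: "\<And>z. f 1 z = 0"
  shows "f x y = 0"
proof -
  have nonzero: "f s y = 0" if "s \<noteq> 0" for s
    using binary_forms_homogeneous[OF f, of s 1 "y / s"] zero that by simp
  obtain p where p: "\<And>z. f (0 + 1 * z) (y + 0 * z) = poly p z"
    using binary_forms_poly[OF f] by blast
  have "poly p 0 = 0" by (rule poly_const_if_eventually) (use p nonzero in auto)
  then show ?thesis using nonzero[of x] p[of 0] by (cases "x = 0") auto
qed

text \<open>If the multiple roots of f + \<alpha>g moved with \<alpha>, the Wronskian of f and g would have
  infinitely many zeros, so f and g would be proportional.\<close>
lemma pencil_common_high_root: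
  fixes f g :: "'i \<Rightarrow> 'k::field_char_0 \<Rightarrow> 'k \<Rightarrow> 'k"
  assumes \<delta>: "\<And>i. i \<in> I \<Longrightarrow> \<delta> i \<noteq> 1"
    and forms: "\<And>i. i \<in> I \<Longrightarrow> f i \<in> binary_forms (\<delta> i)" "\<And>i. i \<in> I \<Longrightarrow> g i \<in> binary_forms (\<delta> i)"
    and ex: "\<And>\<alpha>. \<exists>u. u \<noteq> (0, 0) \<and> (\<forall>i\<in>I. high_root u (\<delta> i) (\<lambda>x y. f i x y + \<alpha> * g i x y))"
  shows "\<exists>u. u \<noteq> (0, 0) \<and> (\<forall>i\<in>I. high_root u (\<delta> i) (f i) \<and> high_root u (\<delta> i) (g i))"
proof -
  from choice[OF allI[OF ex]] obtain U where
    "\<forall>\<alpha>. U \<alpha> \<noteq> (0, 0) \<and> (\<forall>i\<in>I. high_root (U \<alpha>) (\<delta> i) (\<lambda>x y. f i x y + \<alpha> * g i x y))" ..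
  then have U: "U \<alpha> \<noteq> (0, 0)"
    "i \<in> I \<Longrightarrow> high_root (U \<alpha>) (\<delta> i) (\<lambda>x y. f i x y + \<alpha> * g i x y)" for \<alpha> i
    by auto
  show ?thesis
  \<comment> \<open>If two parameters share a root, the two members of the pencil span f and g, so
    the root is common. Otherwise the roots move injectively with \<alpha>.\<close>
  proof (cases "\<exists>\<alpha> \<beta>. \<alpha> \<noteq> \<beta> \<and> br (U \<beta>) (U \<alpha>) = 0")
    case True
    then obtain \<alpha> \<beta> where ab: "\<alpha> \<noteq> \<beta>" "br (U \<beta>) (U \<alpha>) = 0" by blast
    have "high_root (U \<alpha>) (\<delta> i) (f i) \<and> high_root (U \<alpha>) (\<delta> i) (g i)" if i: "i \<in> I" for i
    proof -
      have \<beta>: "high_root (U \<alpha>) (\<delta> i) (\<lambda>x y. f i x y + \<beta> * g i x y)"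
        by (rule high_root_cong[OF U(1) U(1) ab(2) U(2)[OF i]])
      have "(\<lambda>x y. 1 / (\<alpha> - \<beta>) * ((f i x y + \<alpha> * g i x y) + (- 1) * (f i x y + \<beta> * g i x y))) = g i"
        using ab(1) by (auto simp: fun_eq_iff field_simps)
      with high_root_scale[OF high_root_add[OF U(2)[OF i] high_root_scale[OF \<beta>]], of "1 / (\<alpha> - \<beta>)" "-1"]
      have g: "high_root (U \<alpha>) (\<delta> i) (g i)" by simp
      from high_root_add[OF U(2)[OF i] high_root_scale[OF g], of "- \<alpha>"] show ?thesis using g by simp
    qed
    then show ?thesis using U(1) by blast
  next
    case False
    then have sep: "\<alpha> = \<beta>" if "br (U \<beta>) (U \<alpha>) = 0" for \<alpha> \<beta> using that by blast
    \<comment> \<open>Parameters whose root lies in the chart x = 1. At most one is lost, since two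
      roots at infinity would be proportional.\<close>
    define A where "A = {\<alpha>. fst (U \<alpha>) \<noteq> 0}"
    have "finite (- A)"
    proof (cases "- A = {}")
      case False
      then obtain \<alpha> where \<alpha>: "\<alpha> \<in> - A" by blast
      have "\<beta> = \<alpha>" if "\<beta> \<in> - A" for \<beta>
        by (rule sep) (use that \<alpha> in \<open>simp add: A_def br_def\<close>)
      then have "- A \<subseteq> {\<alpha>}" by blast
      then show ?thesis using finite_subset by blast
    qed simp
    then have "infinite A"
      using infinite_UNIV_char_0[where 'a = 'k] finite_Un[of A "- A"] by (simp add: Compl_partition)
    then have inf: "infinite (A - B)" if "finite B" for B
      using that by simp
    define r where "r \<alpha> = snd (U \<alpha>) / fst (U \<alpha>)" for \<alpha>
    have inj: "inj_on r A"
      by (rule inj_onI, rule sep) (auto simp: r_def A_def br_def field_simps)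
    have no_roots: "p = 0" if "finite B" "\<And>\<alpha>. \<alpha> \<in> A - B \<Longrightarrow> poly p (r \<alpha>) = 0" for p :: "'k poly" and B
    proof (rule ccontr)
      assume "p \<noteq> 0"
      have "r ` (A - B) \<subseteq> {z. poly p z = 0}" using that(2) by auto
      then have "finite (r ` (A - B))" using poly_roots_finite[OF \<open>p \<noteq> 0\<close>] finite_subset by blast
      moreover have "inj_on r (A - B)" using inj by (rule inj_on_subset) auto
      ultimately show False using inf[OF that(1)] finite_imageD by blast
    qed
    \<comment> \<open>Moving roots are possible only if all forms vanish, and then any u
      serves.\<close>
    have "f i x y = 0 \<and> g i x y = 0" if i: "i \<in> I" for i x y
    proof (cases "\<delta> i = 0")
      case True
      then have "f i x y + \<alpha> * g i x y = 0" for \<alpha> using U(2)[OF i, of \<alpha>] by (auto simp: high_root_def fun_eq_iff)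
      from this[of 0] this[of 1] show ?thesis by simp
    next
      case False
      with \<delta>[OF i] have "2 \<le> \<delta> i" by linarith
      obtain p where p: "\<And>z. f i (1 + 0 * z) (0 + 1 * z) = poly p z" using binary_forms_poly[OF forms(1)[OF i]] by blast
      obtain q where q: "\<And>z. g i (1 + 0 * z) (0 + 1 * z) = poly q z" using binary_forms_poly[OF forms(2)[OF i]] by blast
      have double: "poly p (r \<alpha>) + \<alpha> * poly q (r \<alpha>) = 0 \<and> poly (pderiv p) (r \<alpha>) + \<alpha> * poly (pderiv q) (r \<alpha>) = 0"
        if "\<alpha> \<in> A" for \<alpha>
      proof -
        obtain h where h: "h \<in> binary_forms (\<delta> i - (\<delta> i div 2 + 1))"
          "\<And>x y. f i x y + \<alpha> * g i x y = br (U \<alpha>) (x, y) ^ (\<delta> i div 2 + 1) * h x y"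
          using U(2)[OF i, of \<alpha>] False by (auto simp: high_root_def fun_eq_iff)
        obtain s where s: "\<And>z. h (1 + 0 * z) (0 + 1 * z) = poly s z" using binary_forms_poly[OF h(1)] by blast
        define l where "l = [:- snd (U \<alpha>), fst (U \<alpha>):]"
        \<comment> \<open>Degree at least 2 makes the root multiple, so the derivative vanishes
          there too.\<close>
        obtain e where e: "\<delta> i div 2 + 1 = Suc (Suc e)"
          using \<open>2 \<le> \<delta> i\<close> by (cases "\<delta> i div 2") (auto simp: div_eq_0_iff)
        have "poly (p + smult \<alpha> q) z = poly (l ^ Suc (Suc e) * s) z" for z
          using h(2)[of "1 + 0 * z" "0 + 1 * z"] unfolding p q s e by (simp add: l_def br_def algebra_simps)
        then have eq: "p + smult \<alpha> q = l ^ Suc (Suc e) * s" using poly_eq_poly_eq_iff by blast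
        have l: "poly l (r \<alpha>) = 0" using that by (simp add: l_def r_def A_def)
        have "poly (p + smult \<alpha> q) (r \<alpha>) = 0" unfolding eq by (simp add: l)
        moreover have "poly (pderiv (p + smult \<alpha> q)) (r \<alpha>) = 0"
          unfolding eq by (simp add: pderiv_mult l)
        ultimately show ?thesis by (simp add: pderiv_add pderiv_smult)
      qed
      have "p * pderiv q - pderiv p * q = 0"
      proof (rule no_roots[of "{}"])
        fix \<alpha> assume "\<alpha> \<in> A - {}"
        with double[of \<alpha>] have "poly p (r \<alpha>) = - \<alpha> * poly q (r \<alpha>)"
          "poly (pderiv p) (r \<alpha>) = - \<alpha> * poly (pderiv q) (r \<alpha>)" by (simp_all add: eq_neg_iff_add_eq_0)
        then show "poly (p * pderiv q - pderiv p * q) (r \<alpha>) = 0" by simp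
      qed simp
      then have W: "p * pderiv q = pderiv p * q" by simp
      have "q = 0"
      proof (rule ccontr)
        assume "q \<noteq> 0"
        from wronskian_zero_imp_proportional[OF W this] obtain c where c: "p = smult c q" by blast
        \<comment> \<open>With p = c q, the member at \<alpha> is (c + \<alpha>) q, so q vanishes at
          the root of every parameter except possibly - c.\<close>
        have "q = 0"
        proof (rule no_roots[of "{- c}"])
          fix \<alpha> assume \<alpha>: "\<alpha> \<in> A - {- c}"
          then have "(c + \<alpha>) * poly q (r \<alpha>) = 0" using double[of \<alpha>] c by (simp add: distrib_right)
          moreover have "c + \<alpha> \<noteq> 0" using \<alpha> by (auto simp: add_eq_0_iff)
          ultimately show "poly q (r \<alpha>) = 0" by simp
        qed simp
        with \<open>q \<noteq> 0\<close> show False ..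
      qed
      moreover have "p = 0"
        by (rule no_roots[of "{}"]) (use double \<open>q = 0\<close> in auto)
      ultimately show ?thesis
        using p q binary_form_eq_zero[OF forms(1)[OF i]] binary_form_eq_zero[OF forms(2)[OF i]] by simp
    qed
    then have "f i = (\<lambda>x y. 0)" "g i = (\<lambda>x y. 0)" if "i \<in> I" for i using that by (auto simp: fun_eq_iff)
    then show ?thesis using U(1) by (intro exI[of _ "U 0"]) (simp add: high_root_zero)
  qed
qed

section \<open>Nullcones through common roots, and the polarization index\<close>

context
  assumes alg_closed: "\<forall>p :: 'k::field_char_0 poly. 0 < degree p \<longrightarrow> (\<exists>x. poly p x = 0)"
begin

lemma null_iff_common_high_root:
  fixes w :: "'i \<times> 'k \<times> 'k \<Rightarrow> 'k"
  assumes "finite I" "w \<in> form_families I \<delta>"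
  shows "(\<forall>F\<in>invariants (form_families I \<delta>). F w = F (\<lambda>_. 0)) \<longleftrightarrow>
    (\<exists>u. u \<noteq> (0, 0) \<and> (\<forall>i\<in>I. high_root u (\<delta> i) (\<lambda>x y. w (i, x, y))))"
  using common_high_root_if_invariants_vanish[OF alg_closed assms(2)]
    invariants_vanish_if_common_high_root[OF assms] by blast

lemma nullcone_iff:
  fixes w :: "(nat \<times> nat) \<times> 'k \<times> 'k \<Rightarrow> 'k"
  assumes "w \<in> Vsum n ds"
  shows "w \<in> nullcone n ds \<longleftrightarrow>
    (\<exists>u. u \<noteq> (0, 0) \<and> (\<forall>t<n. \<forall>i<length ds. high_root u (ds ! i) (\<lambda>x y. w ((t, i), x, y))))"
proof -
  have "w \<in> nullcone n ds \<longleftrightarrow>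
      (\<exists>u. u \<noteq> (0, 0) \<and> (\<forall>j\<in>{..<n} \<times> {..<length ds}. high_root u ((\<lambda>(t, i). ds ! i) j) (\<lambda>x y. w (j, x, y))))"
    unfolding nullcone_def Vsum_eq_form_families
    using assms[unfolded Vsum_eq_form_families] by (subst null_iff_common_high_root[symmetric]) auto
  moreover have "(\<forall>j\<in>{..<n} \<times> {..<length ds}. high_root u ((\<lambda>(t, i). ds ! i) j) (\<lambda>x y. w (j, x, y))) \<longleftrightarrow>
      (\<forall>t<n. \<forall>i<length ds. high_root u (ds ! i) (\<lambda>x y. w ((t, i), x, y)))" for u
    by auto
  ultimately show ?thesis by (simp only:)
qed

lemma pol_nullcone_iff:
  fixes w :: "(nat \<times> nat) \<times> 'k \<times> 'k \<Rightarrow> 'k"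
  assumes w: "w \<in> Vsum n ds"
  shows "w \<in> pol_nullcone n ds \<longleftrightarrow>
    (\<forall>\<alpha>. \<exists>u. u \<noteq> (0, 0) \<and> (\<forall>i<length ds. high_root u (ds ! i) (\<lambda>x y. \<Sum>t<n. \<alpha> t * w ((t, i), x, y))))"
proof -
  have "(\<forall>f\<in>invariants (Vspace ds). f (lin_comb n \<alpha> w) = f (\<lambda>_. 0)) \<longleftrightarrow>
     (\<exists>u. u \<noteq> (0, 0) \<and> (\<forall>i<length ds. high_root u (ds ! i) (\<lambda>x y. \<Sum>t<n. \<alpha> t * w ((t, i), x, y))))" for \<alpha>
    using null_iff_common_high_root[OF _ lin_comb_in_Vspace[OF w, unfolded Vspace_eq_form_families], of \<alpha>]
    unfolding Vspace_eq_form_families by (simp add: lin_comb_def Ball_def)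
  then show ?thesis unfolding pol_nullcone_iff_invariants[OF w] by simp
qed

lemma nullcone_subset_pol_nullcone:
  "(nullcone n ds :: ((nat \<times> nat) \<times> 'k \<times> 'k \<Rightarrow> 'k) set) \<subseteq> pol_nullcone n ds"
proof
  fix w :: "(nat \<times> nat) \<times> 'k \<times> 'k \<Rightarrow> 'k" assume "w \<in> nullcone n ds"
  moreover from this have w: "w \<in> Vsum n ds" by (simp add: nullcone_def)
  ultimately obtain u where u: "u \<noteq> (0, 0)"
    "\<And>t i. t < n \<Longrightarrow> i < length ds \<Longrightarrow> high_root u (ds ! i) (\<lambda>x y. w ((t, i), x, y))"
    using nullcone_iff[OF w] by blast
  then show "w \<in> pol_nullcone n ds"
    unfolding pol_nullcone_iff[OF w]
    by (intro allI exI[of _ u] conjI impI high_root_sum high_root_scale) auto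
qed

lemma nullcone_1_eq:
  "(nullcone 1 ds :: ((nat \<times> nat) \<times> 'k \<times> 'k \<Rightarrow> 'k) set) = pol_nullcone 1 ds"
proof (rule antisym[OF nullcone_subset_pol_nullcone], rule subsetI)
  fix w :: "(nat \<times> nat) \<times> 'k \<times> 'k \<Rightarrow> 'k" assume null: "w \<in> pol_nullcone 1 ds"
  then have w: "w \<in> Vsum 1 ds" by (simp add: pol_nullcone_def)
  from null[unfolded pol_nullcone_iff[OF w], rule_format, of "\<lambda>_. 1"]
  show "w \<in> nullcone 1 ds" unfolding nullcone_iff[OF w] by simp
qed

text \<open>Pencils yield a common root only for two vectors at a time. A nonzero component v t i
  serves as anchor: its high root is unique up to scaling, so the roots obtained from all pairs
  containing t agree.\<close>

lemma nullcone_eq_if_no_linear_forms: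
  assumes "1 \<notin> set ds"
  shows "(nullcone n ds :: ((nat \<times> nat) \<times> 'k \<times> 'k \<Rightarrow> 'k) set) = pol_nullcone n ds"
proof (rule antisym[OF nullcone_subset_pol_nullcone], rule subsetI)
  fix w :: "(nat \<times> nat) \<times> 'k \<times> 'k \<Rightarrow> 'k" assume null: "w \<in> pol_nullcone n ds"
  then have w: "w \<in> Vsum n ds" by (simp add: pol_nullcone_def)
  define v where "v t i x y = w ((t, i), x, y)" for t i x y
  have v: "v t i \<in> binary_forms (ds ! i)" if "t < n" "i < length ds" for t i
    using w that unfolding Vsum_eq_form_families form_families_def v_def[abs_def] by auto
  have span: "\<exists>u. u \<noteq> (0, 0) \<and> (\<forall>i<length ds. high_root u (ds ! i) (\<lambda>x y. \<Sum>t<n. \<alpha> t * v t i x y))" for \<alpha>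
    using null unfolding pol_nullcone_iff[OF w] v_def by blast
  have pair: "\<exists>u. u \<noteq> (0, 0) \<and> (\<forall>i\<in>{..<length ds}. high_root u (ds ! i) (v t i) \<and> high_root u (ds ! i) (v t' i))"
    if "t < n" "t' < n" for t t'
  proof (rule pencil_common_high_root)
    fix a
    \<comment> \<open>Writing the coefficients as a sum of two indicators also covers t =
      t'.\<close>
    have "(\<Sum>s<n. ((if s = t then 1 else 0) + (if s = t' then a else 0)) * v s i x y) = v t i x y + a * v t' i x y" for i x y
      using that by (simp add: distrib_right sum.distrib if_distrib[of "\<lambda>c. c * _"] cong: if_cong)
    with span[of "\<lambda>s. (if s = t then 1 else 0) + (if s = t' then a else 0)"]
    show "\<exists>u. u \<noteq> (0, 0) \<and> (\<forall>i\<in>{..<length ds}. high_root u (ds ! i) (\<lambda>x y. v t i x y + a * v t' i x y))"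
      by (simp only: Ball_def lessThan_iff)
  next
    fix i assume "i \<in> {..<length ds}"
    then have i: "i < length ds" by simp
    show "ds ! i \<noteq> 1" using assms nth_mem[OF i] by metis
    show "v t i \<in> binary_forms (ds ! i)" "v t' i \<in> binary_forms (ds ! i)" using that i by (auto intro: v)
  qed
  have "\<exists>u. u \<noteq> (0, 0) \<and> (\<forall>t<n. \<forall>i<length ds. high_root u (ds ! i) (v t i))"
  proof (cases "\<exists>t<n. \<exists>i<length ds. \<exists>x y. v t i x y \<noteq> 0")
    case False
    then have "v t i = (\<lambda>x y. 0)" if "t < n" "i < length ds" for t i using that by (auto simp: fun_eq_iff)
    then show ?thesis by (intro exI[of _ "(1, 0)"]) (auto simp: high_root_zero)
  next
    case True
    then obtain t i x y where t: "t < n" and i: "i < length ds" and nz: "v t i x y \<noteq> 0" by blast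
    obtain u where u: "u \<noteq> (0, 0)" "high_root u (ds ! i) (v t i)" using pair[OF t t] i by blast
    have "high_root u (ds ! j) (v s j)" if s: "s < n" and j: "j < length ds" for s j
    proof -
      obtain u' where u': "u' \<noteq> (0, 0)" "high_root u' (ds ! i) (v t i)" "high_root u' (ds ! j) (v s j)"
        using pair[OF t s] i j by blast
      then have "br u' u = 0" using high_root_unique[OF v[OF t i] u'(2) u(2)] nz by blast
      then show ?thesis using high_root_cong[OF u'(1) u(1) _ u'(3)] by blast
    qed
    with u(1) show ?thesis by blast
  qed
  then show "w \<in> nullcone n ds" unfolding nullcone_iff[OF w] v_def .
qed

lemma nullcone_neq_if_linear_form:
  assumes "1 \<in> set ds" "2 \<le> n"
  shows "(nullcone n ds :: ((nat \<times> nat) \<times> 'k \<times> 'k \<Rightarrow> 'k) set) \<noteq> pol_nullcone n ds"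
proof -
  obtain k where k: "k < length ds" "ds ! k = 1" using assms(1) by (auto simp: in_set_conv_nth)
  define w :: "(nat \<times> nat) \<times> 'k \<times> 'k \<Rightarrow> 'k" where
    "w = (\<lambda>((t, i), x, y). if i = k then (if t = 0 then x else if t = 1 then y else 0) else 0)"
  have wk: "w ((t, i), x, y) = (if i = k then (if t = 0 then x else if t = 1 then y else 0) else 0)" for t i x y
    by (simp add: w_def)
  have w: "w \<in> Vsum n ds"
  proof -
    have "(\<lambda>x y. w ((t, i), x, y)) \<in> binary_forms (ds ! i)" for t i
      using k binary_forms_linear[of 1 "0 :: 'k"] binary_forms_linear[of 0 "1 :: 'k"]
      by (cases "i = k"; cases "t = 0"; cases "t = 1") (simp_all add: wk binary_forms_zero)
    then show ?thesis
      using k assms(2) by (auto simp: Vsum_eq_form_families form_families_def wk)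
  qed
  have "w \<in> pol_nullcone n ds"
    unfolding pol_nullcone_iff[OF w]
  proof
    fix \<alpha> :: "nat \<Rightarrow> 'k"
    have sum: "(\<Sum>t<n. \<alpha> t * w ((t, i), x, y)) = (if i = k then \<alpha> 0 * x + \<alpha> 1 * y else 0)" for i x y
    proof -
      have "(\<Sum>t<n. \<alpha> t * w ((t, i), x, y)) = (\<Sum>t\<in>{0, 1}. \<alpha> t * w ((t, i), x, y))"
        using assms(2) by (intro sum.mono_neutral_right) (auto simp: wk)
      then show ?thesis by (simp add: wk)
    qed
    show "\<exists>u. u \<noteq> (0, 0) \<and> (\<forall>i<length ds. high_root u (ds ! i) (\<lambda>x y. \<Sum>t<n. \<alpha> t * w ((t, i), x, y)))"
    proof (cases "\<alpha> 0 = 0 \<and> \<alpha> 1 = 0")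
      case True
      then have "(\<lambda>x y. \<Sum>t<n. \<alpha> t * w ((t, i), x, y)) = (\<lambda>x y. 0)" for i by (intro ext) (simp add: sum)
      then show ?thesis by (intro exI[of _ "(1, 0)"]) (simp add: high_root_zero)
    next
      case False
      \<comment> \<open>The bracket with this vector is the form itself, with cofactor 1.\<close>
      have "high_root (\<alpha> 1, - \<alpha> 0) (Suc 0) (\<lambda>x y. \<alpha> 0 * x + \<alpha> 1 * y)"
        using binary_forms_const[of 1] by (auto simp: high_root_def br_def fun_eq_iff intro!: bexI[of _ "\<lambda>x y. 1"])
      then have "high_root (\<alpha> 1, - \<alpha> 0) (ds ! i) (\<lambda>x y. if i = k then \<alpha> 0 * x + \<alpha> 1 * y else 0)" for i
        using k by (cases "i = k") (simp_all add: high_root_zero)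
      then show ?thesis using False unfolding sum by (intro exI[of _ "(\<alpha> 1, - \<alpha> 0)"]) auto
    qed
  qed
  moreover have "w \<notin> nullcone n ds"
  proof
    assume "w \<in> nullcone n ds"
    then obtain u where u: "u \<noteq> (0, 0)"
      "\<And>t. t < n \<Longrightarrow> high_root u (ds ! k) (\<lambda>x y. w ((t, k), x, y))"
      using nullcone_iff[OF w] k by blast
    have "fst u = 0" "snd u = 0"
      using high_root_imp_root[OF u(2)[of 0]] high_root_imp_root[OF u(2)[of 1]] assms(2)
      unfolding wk by auto
    with u(1) show False by (simp add: prod_eq_iff)
  qed
  ultimately show ?thesis by blast
qed

end

theorem theorem3p15:
  fixes ds :: "nat list"
  assumes alg_closed: "\<forall>p :: 'k::field_char_0 poly. 0 < degree p \<longrightarrow> (\<exists>x. poly p x = 0)"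
  shows "pol_ind TYPE('k) ds = (if 1 \<in> set ds then 1 else \<infinity>)"
proof (cases "1 \<in> set ds")
  case True
  have "n = 1" if "1 \<le> n" "(nullcone n ds :: ((nat \<times> nat) \<times> 'k \<times> 'k \<Rightarrow> 'k) set) = pol_nullcone n ds" for n
    using nullcone_neq_if_linear_form[OF alg_closed True, of n] that by linarith
  then have "{n. 1 \<le> n \<and> (nullcone n ds :: ((nat \<times> nat) \<times> 'k \<times> 'k \<Rightarrow> 'k) set) = pol_nullcone n ds} = {1}"
    using nullcone_1_eq[OF alg_closed, of ds] by auto
  then show ?thesis using True by (simp add: pol_ind_def one_enat_def)
next
  case False
  then have "{n. 1 \<le> n \<and> (nullcone n ds :: ((nat \<times> nat) \<times> 'k \<times> 'k \<Rightarrow> 'k) set) = pol_nullcone n ds} = {1..}"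
    using nullcone_eq_if_no_linear_forms[OF alg_closed False] by auto
  moreover have "infinite (enat ` {1..})" by (simp add: finite_image_iff infinite_Ici inj_on_def)
  ultimately show ?thesis using False by (auto simp: pol_ind_def Sup_enat_def)
qed

end
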